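(* Let $\Lambda$ be a space with measure $\mu$. Suppose $K(x,y)$ is a quaternion kernel on $\Lambda$ that is finite-rank, quasi-real and completely positive, with diagonal form $K(x,y)=\sum_{k}\lambda_ku_k(x)u_k^*(y)$ (a finite sum) and eigenvalues $\lambda_k\in[0,1]$. Let $\xi_k$ be independent Bernoulli random variables, where $\xi_k$ takes value $1$ with probability $\lambda_k$ and value $0$ with probability $1-\lambda_k$, and define the random kernel $$K_\xi(x,y)=\sum_{k}\xi_ku_k(x)u_k^*(y).$$ Let $\mathcal{X}_\xi$ be a random point field which is a mix of Pfaffian point fields with random kernels $K_\xi(x,y)$ (i.e. conditionally on $\xi=(\xi_k)$, $\mathcal{X}_\xi$ is a Pfaffian point field with kernel $K_\xi$). Then $\mathcal{X}_\xi$ is a Pfaffian point field with the kernel $K(x,y)$.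
   Context: Quaternions. "Quaternions" are complexified quaternions $q=s+x\mathbf{i}+y\mathbf{j}+z\mathbf{k}\in\mathbb{Q}_{\mathbb{C}}$ with $s,x,y,z\in\mathbb{C}$ (usual quaternion multiplication rules, complex scalars central). The conjugate is $q^{*}=s-x\mathbf{i}-y\mathbf{j}-z\mathbf{k}$ (the coefficients are not complex-conjugated). The dual $X^*$ of a quaternion matrix is given by $(X^* )_{lk}=(X_{kl})^*$; $X$ is self-dual if $X^*=X$. A quaternion kernel $K:\Lambda\times\Lambda\to\mathbb{Q}_{\mathbb{C}}$ is self-dual if $K(y,x)=K(x,y)^*$. Moore-Dyson determinant. For an $n\times n$ quaternion matrix $X$, write each permutation $\sigma\in S_n$ as a product of cycles $\sigma=(n_1i_2\ldots i_s)(n_2j_2\ldots j_t)\ldots(n_rk_2\ldots k_l)$ where $n_i$ is the largest element of its cycle and $n_1>n_2>\ldots>n_r$. Then $\mathrm{Det}_M(X)=\sum_{\sigma}(-1)^{n-r}\left(X_{n_1i_2}X_{i_2i_3}\ldots X_{i_sn_1}\right)\ldots\left(X_{n_rk_2}X_{k_2k_3}\ldots X_{k_ln_r}\right)$. It is scalar for self-dual $X$. Random point fields. A random point field on $\Lambda$ is a probability measure on the space of countable configurations of points of $\Lambda$ (with finitely many points in every compact subset). $\#(A)$ is the number of points in $A$. A locally integrable $R_k:\Lambda^k\to\mathbb{R}_+$ is the $k$-point correlation function with respect to $\mu$ if for all disjoint measurable $A_1,\ldots,A_m\subset\Lambda$ and non-negative integers $k_i$ with $\sum k_i=k$: $\mathbb{E}\prod_{i=1}^m[\#(A_i)\cdots(\#(A_i)-k_i+1)]=\int_{A_1^{k_1}\times\cdots\times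 A_m^{k_m}}R_k\,d\mu(x_1)\cdots d\mu(x_k)$. Correlation functions are defined up to sets of measure $0$. The field is Pfaffian with kernel $K$ if $K$ is a self-dual quaternion kernel and $R_m(x_1,\ldots,x_m)=\mathrm{Det}_M(K(x_i,x_j))_{1\le i,j\le m}$ for all $m\ge1$. Diagonal forms and positivity. $K$ has a diagonal form with eigenvalues $\lambda_k$ if $K(x,y)=\sum_k\lambda_ku_k(x)u_k^*(y)$ with scalar $\lambda_k$ and $u_k:\Lambda\to\mathbb{Q}_{\mathbb{C}}$ orthonormal: $\int_\Lambda u_k^*(x)u_l(x)\,d\mu(x)=\delta_{kl}$. It is quasi-real if it has a diagonal form with real eigenvalues. A kernel $K$ is positive if $\mathrm{Det}_M(K(x_i,x_j))_{1\le i,j\le m}\ge0$ for all $m\ge 1$ and all $x_1,\ldots,x_m\in\Lambda$. A quasi-real kernel $K$ with orthonormal set of eigenfunctions $\{u_i\}$ (those of its diagonal form) is completely positive if, for every subset $I$ of the set of indices of all eigenfunctions, the kernel $K_I(x,y)=\sum_{i\in I}u_i(x)u_i^*(y)$ is positive. *)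

theory Defs
  imports "HOL-Probability.Probability" "HOL-Combinatorics.Combinatorics"
begin

section \<open>Complexified quaternions\<close>

datatype cquat = CQuat (qs: complex) (qi: complex) (qj: complex) (qk: complex)

lemma cquat_eqI:
  "qs p = qs q \<Longrightarrow> qi p = qi q \<Longrightarrow> qj p = qj q \<Longrightarrow> qk p = qk q \<Longrightarrow> p = q"
  by (cases p; cases q) simp

instantiation cquat :: ring_1
begin

definition zero_cquat :: cquat where "0 = CQuat 0 0 0 0"

definition one_cquat :: cquat where "1 = CQuat 1 0 0 0"

definition plus_cquat :: "cquat \<Rightarrow> cquat \<Rightarrow> cquat" where
  "p + q = CQuat (qs p + qs q) (qi p + qi q) (qj p + qj q) (qk p + qk q)"

definition minus_cquat :: "cquat \<Rightarrow> cquat \<Rightarrow> cquat" where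
  "p - q = CQuat (qs p - qs q) (qi p - qi q) (qj p - qj q) (qk p - qk q)"

definition uminus_cquat :: "cquat \<Rightarrow> cquat" where
  "- p = CQuat (- qs p) (- qi p) (- qj p) (- qk p)"

definition times_cquat :: "cquat \<Rightarrow> cquat \<Rightarrow> cquat" where
  "p * q = CQuat
     (qs p * qs q - qi p * qi q - qj p * qj q - qk p * qk q)
     (qs p * qi q + qi p * qs q + qj p * qk q - qk p * qj q)
     (qs p * qj q - qi p * qk q + qj p * qs q + qk p * qi q)
     (qs p * qk q + qi p * qj q - qj p * qi q + qk p * qs q)"

instance
  by standard
    (simp_all add: zero_cquat_def one_cquat_def plus_cquat_def minus_cquat_def
      uminus_cquat_def times_cquat_def algebra_simps)

end

definition cq_of_complex :: "complex \<Rightarrow> cquat" where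
  "cq_of_complex c = CQuat c 0 0 0"

text \<open>The coefficients are not complex-conjugated.\<close>

definition cq_conj :: "cquat \<Rightarrow> cquat" where
  "cq_conj q = CQuat (qs q) (- qi q) (- qj q) (- qk q)"

definition cq_nonneg :: "cquat \<Rightarrow> bool" where
  "cq_nonneg q \<longleftrightarrow> (\<exists>r::real. 0 \<le> r \<and> q = cq_of_complex (of_real r))"

definition has_cq_integral :: "'a measure \<Rightarrow> ('a \<Rightarrow> cquat) \<Rightarrow> cquat \<Rightarrow> bool" where
  "has_cq_integral M f q \<longleftrightarrow>
     has_bochner_integral M (\<lambda>x. qs (f x)) (qs q) \<and>
     has_bochner_integral M (\<lambda>x. qi (f x)) (qi q) \<and>
     has_bochner_integral M (\<lambda>x. qj (f x)) (qj q) \<and>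
     has_bochner_integral M (\<lambda>x. qk (f x)) (qk q)"


section \<open>The Moore--Dyson determinant\<close>

text \<open>
  \<open>support \<sigma> a\<close> is the cycle \<open>[a, \<sigma> a, \<sigma> (\<sigma> a), \<dots>]\<close> of \<open>a\<close>, so \<open>cycle_prod X \<sigma> a\<close> is the ordered
  product \<open>X a (\<sigma> a) * X (\<sigma> a) (\<sigma> (\<sigma> a)) * \<dots>\<close> around it, ending with the factor whose second
  index is \<open>a\<close>.  Fixed points form cycles of length one.  Rows and columns are indexed from \<open>0\<close>.
\<close>

definition cycle_prod :: "(nat \<Rightarrow> nat \<Rightarrow> cquat) \<Rightarrow> (nat \<Rightarrow> nat) \<Rightarrow> nat \<Rightarrow> cquat" where
  "cycle_prod X \<sigma> a = prod_list (map (\<lambda>i. X i (\<sigma> i)) (support \<sigma> a))"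

definition cycle_maxima :: "nat \<Rightarrow> (nat \<Rightarrow> nat) \<Rightarrow> nat set" where
  "cycle_maxima n \<sigma> = {a \<in> {..<n}. \<forall>b \<in> set (support \<sigma> a). b \<le> a}"

definition DetM :: "nat \<Rightarrow> (nat \<Rightarrow> nat \<Rightarrow> cquat) \<Rightarrow> cquat" where
  "DetM n X = (\<Sum>\<sigma> | \<sigma> permutes {..<n}.
     (- 1) ^ (n - card (cycle_maxima n \<sigma>)) *
     prod_list (map (cycle_prod X \<sigma>) (rev (sorted_list_of_set (cycle_maxima n \<sigma>)))))"


section \<open>Quaternion kernels\<close>

definition self_dual_kernel :: "('a \<Rightarrow> 'a \<Rightarrow> cquat) \<Rightarrow> bool" where
  "self_dual_kernel K \<longleftrightarrow> (\<forall>x y. K y x = cq_conj (K x y))"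

definition positive_kernel :: "('a \<Rightarrow> 'a \<Rightarrow> cquat) \<Rightarrow> bool" where
  "positive_kernel K \<longleftrightarrow>
     (\<forall>m\<ge>1. \<forall>x :: nat \<Rightarrow> 'a. cq_nonneg (DetM m (\<lambda>i j. K (x i) (x j))))"

definition diag_kernel ::
  "'i set \<Rightarrow> ('i \<Rightarrow> complex) \<Rightarrow> ('i \<Rightarrow> 'a \<Rightarrow> cquat) \<Rightarrow> 'a \<Rightarrow> 'a \<Rightarrow> cquat" where
  "diag_kernel I c u x y = (\<Sum>k\<in>I. cq_of_complex (c k) * u k x * cq_conj (u k y))"

definition orthonormal :: "'a measure \<Rightarrow> 'i set \<Rightarrow> ('i \<Rightarrow> 'a \<Rightarrow> cquat) \<Rightarrow> bool" where
  "orthonormal M I u \<longleftrightarrow>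
     (\<forall>k\<in>I. \<forall>l\<in>I. has_cq_integral M (\<lambda>x. cq_conj (u k x) * u l x) (if k = l then 1 else 0))"

text \<open>Diagonal forms of finite-rank kernels: the index set is required to be finite.\<close>

definition diagonal_form ::
  "'a measure \<Rightarrow> 'i set \<Rightarrow> ('i \<Rightarrow> complex) \<Rightarrow> ('i \<Rightarrow> 'a \<Rightarrow> cquat) \<Rightarrow> ('a \<Rightarrow> 'a \<Rightarrow> cquat) \<Rightarrow> bool" where
  "diagonal_form M I lam u K \<longleftrightarrow>
     finite I \<and> orthonormal M I u \<and> (\<forall>x y. K x y = diag_kernel I lam u x y)"

definition quasi_real ::
  "'a measure \<Rightarrow> 'i set \<Rightarrow> ('i \<Rightarrow> 'a \<Rightarrow> cquat) \<Rightarrow> ('a \<Rightarrow> 'a \<Rightarrow> cquat) \<Rightarrow> bool" where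
  "quasi_real M I u K \<longleftrightarrow> (\<exists>lam. (\<forall>k\<in>I. lam k \<in> \<real>) \<and> diagonal_form M I lam u K)"

definition completely_positive ::
  "'a measure \<Rightarrow> 'i set \<Rightarrow> ('i \<Rightarrow> 'a \<Rightarrow> cquat) \<Rightarrow> ('a \<Rightarrow> 'a \<Rightarrow> cquat) \<Rightarrow> bool" where
  "completely_positive M I u K \<longleftrightarrow>
     quasi_real M I u K \<and> (\<forall>J\<subseteq>I. positive_kernel (diag_kernel J (\<lambda>_. 1) u))"


section \<open>Random point fields\<close>

text \<open>A configuration is given by its multiplicity function; multiple points are allowed.\<close>

definition configurations :: "('a::topological_space \<Rightarrow> nat) set" where
  "configurations =
     {w. countable {x. w x \<noteq> 0} \<and> (\<forall>C. compact C \<longrightarrow> finite {x \<in> C. w x \<noteq> 0})}"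

definition num_points :: "'a set \<Rightarrow> ('a \<Rightarrow> nat) \<Rightarrow> ennreal" where
  "num_points A w = (\<integral>\<^sup>+x\<in>A. of_nat (w x) \<partial>count_space UNIV)"

text \<open>The \<open>\<sigma>\<close>-algebra on configurations is the one generated by the point counts.\<close>

definition config_space :: "'a::topological_space measure \<Rightarrow> ('a \<Rightarrow> nat) measure" where
  "config_space M = sigma configurations
     {num_points A -` B \<inter> configurations | A B. A \<in> sets M \<and> B \<in> sets borel}"

definition random_point_field ::
  "'a::topological_space measure \<Rightarrow> ('a \<Rightarrow> nat) measure \<Rightarrow> bool" where
  "random_point_field M P \<longleftrightarrow> prob_space P \<and> sets P = sets (config_space M)"

text \<open>
  Subtraction on \<open>ennreal\<close> is truncated, but the falling factorial is still the right one: if the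
  number of points \<open>n\<close> is finite and less than \<open>k\<close>, then the factor with \<open>j = n\<close> is zero.
\<close>

definition falling :: "ennreal \<Rightarrow> nat \<Rightarrow> ennreal" where
  "falling t k = (\<Prod>j<k. t - of_nat j)"

text \<open>
  The set \<open>A\<^sub>0\<close> to the power \<open>\<kappa> 0\<close>, times \<open>A\<^sub>1\<close> to the power \<open>\<kappa> 1\<close>, and so on, as a set of
  tuples with \<open>\<kappa> 0 + \<dots> + \<kappa> (m - 1)\<close> entries.
\<close>

definition block_product :: "nat \<Rightarrow> (nat \<Rightarrow> nat) \<Rightarrow> (nat \<Rightarrow> 'a set) \<Rightarrow> (nat \<Rightarrow> 'a) set" where
  "block_product m \<kappa> A =
     {x \<in> {..<(\<Sum>i<m. \<kappa> i)} \<rightarrow>\<^sub>E UNIV. \<forall>i<m. \<forall>j \<in> {(\<Sum>l<i. \<kappa> l)..<(\<Sum>l<Suc i. \<kappa> l)}. x j \<in> A i}"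

definition locally_integrable ::
  "'a::topological_space measure \<Rightarrow> nat \<Rightarrow> ((nat \<Rightarrow> 'a) \<Rightarrow> real) \<Rightarrow> bool" where
  "locally_integrable M k R \<longleftrightarrow>
     (\<forall>C. compact C \<and> C \<in> sets M \<longrightarrow>
        set_integrable (PiM {..<k} (\<lambda>_. M)) ({..<k} \<rightarrow>\<^sub>E C) R)"

definition correlation_function ::
  "'a::topological_space measure \<Rightarrow> ('a \<Rightarrow> nat) measure \<Rightarrow> nat \<Rightarrow> ((nat \<Rightarrow> 'a) \<Rightarrow> real) \<Rightarrow> bool" where
  "correlation_function M P k R \<longleftrightarrow>
     R \<in> borel_measurable (PiM {..<k} (\<lambda>_. M)) \<and>
     (\<forall>x. 0 \<le> R x) \<and>
     locally_integrable M k R \<and>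
     (\<forall>m \<kappa> A. (\<forall>i<m. A i \<in> sets M) \<and> disjoint_family_on A {..<m} \<and> (\<Sum>i<m. \<kappa> i) = k \<longrightarrow>
        (\<integral>\<^sup>+w. (\<Prod>i<m. falling (num_points (A i) w) (\<kappa> i)) \<partial>P) =
        (\<integral>\<^sup>+x\<in>block_product m \<kappa> A. ennreal (R x) \<partial>PiM {..<k} (\<lambda>_. M)))"

text \<open>
  Correlation functions are only defined up to null sets, so the determinantal formula is required
  almost everywhere.
\<close>

definition pfaffian_field ::
  "'a::topological_space measure \<Rightarrow> ('a \<Rightarrow> 'a \<Rightarrow> cquat) \<Rightarrow> ('a \<Rightarrow> nat) measure \<Rightarrow> bool" where
  "pfaffian_field M K P \<longleftrightarrow>
     random_point_field M P \<and> self_dual_kernel K \<and>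
     (\<forall>m\<ge>1. \<exists>R. correlation_function M P m R \<and>
        (AE x in PiM {..<m} (\<lambda>_. M).
           DetM m (\<lambda>i j. K (x i) (x j)) = cq_of_complex (of_real (R x))))"

text \<open>
  \<open>X\<close> is a random configuration on the probability space \<open>N\<close>.  For every value \<open>b\<close> that
  \<open>(\<xi> k)\<^sub>k\<close> attains with positive probability, the conditional law of \<open>X\<close> given
  \<open>\<xi> = b\<close> is required to be Pfaffian with kernel \<open>K\<^sub>b\<close>.
\<close>

definition pfaffian_mixture ::
  "'a::topological_space measure \<Rightarrow> 'w measure \<Rightarrow> 'i set \<Rightarrow> ('i \<Rightarrow> 'w \<Rightarrow> real) \<Rightarrow>
   (('i \<Rightarrow> real) \<Rightarrow> 'a \<Rightarrow> 'a \<Rightarrow> cquat) \<Rightarrow> ('w \<Rightarrow> 'a \<Rightarrow> nat) \<Rightarrow> bool" where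
  "pfaffian_mixture M N I \<xi> Kb X \<longleftrightarrow>
     X \<in> measurable N (config_space M) \<and>
     (\<forall>b. let E = {w \<in> space N. \<forall>k\<in>I. \<xi> k w = b k} in
        measure N E > 0 \<longrightarrow>
        pfaffian_field M (Kb b) (distr (uniform_measure N E) (config_space M) X))"

end

theory Submission
  imports Defs
begin

text \<open>
  The point is that \<open>\<lambda> \<mapsto> Det\<^sub>M (K\<^sub>\<lambda>(x\<^sub>i, x\<^sub>j))\<close> is affine in each eigenvalue separately, so that it
  commutes with the expectation over independent Bernoulli variables; the correlation functions of
  the mixture are then the corresponding averages.

  Changing one eigenvalue perturbs a self-dual matrix \<open>X\<close> to \<open>X + c v v\<^sup>*\<close>.  Expanding the
  determinant along the cycle of the largest index turns it into a signed sum over self-avoiding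
  paths, weighted by the determinant of the remaining indices, which is central because reversing
  a path dualises its weight.  By induction on the index set,
  \<open>Det\<^sub>M (X + c v v\<^sup>*) = Det\<^sub>M X + c G\<close>, where \<open>G\<close> is the sum over paths \<open>\<gamma>\<close> of
  \<open>v\<^sup>* X\<^sub>\<gamma> v\<close> times the determinant off \<open>\<gamma>\<close>.  Terms with two or more factors \<open>c\<close> contain two
  disjoint such paths; since \<open>G\<close> is central too, these can be exchanged, and they cancel.
\<close>

section \<open>Scalars among the quaternions\<close>

lemma cq_conj_mult: "cq_conj (p * q) = cq_conj q * cq_conj p"
  by (rule cquat_eqI) (simp_all add: cq_conj_def times_cquat_def algebra_simps)

lemma cq_conj_add: "cq_conj (p + q) = cq_conj p + cq_conj q"
  by (rule cquat_eqI) (simp_all add: cq_conj_def plus_cquat_def)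

lemma cq_conj_diff: "cq_conj (p - q) = cq_conj p - cq_conj q"
  by (rule cquat_eqI) (simp_all add: cq_conj_def minus_cquat_def)

lemma cq_conj_minus: "cq_conj (- p) = - cq_conj p"
  by (rule cquat_eqI) (simp_all add: cq_conj_def uminus_cquat_def)

lemma cq_conj_0 [simp]: "cq_conj 0 = 0"
  by (rule cquat_eqI) (simp_all add: cq_conj_def zero_cquat_def)

lemma cq_conj_1 [simp]: "cq_conj 1 = 1"
  by (rule cquat_eqI) (simp_all add: cq_conj_def one_cquat_def)

lemma cq_conj_cq_conj [simp]: "cq_conj (cq_conj p) = p"
  by (rule cquat_eqI) (simp_all add: cq_conj_def)

lemma cq_conj_sum: "cq_conj (\<Sum>i\<in>A. f i) = (\<Sum>i\<in>A. cq_conj (f i))"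
  by (induction A rule: infinite_finite_induct) (simp_all add: cq_conj_add)

lemma cq_conj_of_complex [simp]: "cq_conj (cq_of_complex c) = cq_of_complex c"
  by (rule cquat_eqI) (simp_all add: cq_conj_def cq_of_complex_def)

lemma qs_add: "qs (p + q) = qs p + qs q"
  by (simp add: plus_cquat_def)

lemma qs_diff: "qs (p - q) = qs p - qs q"
  by (simp add: minus_cquat_def)

lemma qs_sum: "qs (\<Sum>i\<in>A. f i) = (\<Sum>i\<in>A. qs (f i))"
  by (induction A rule: infinite_finite_induct) (simp_all add: qs_add zero_cquat_def)

text \<open>The scalar part is half the trace in the representation by complex 2x2 matrices, hence
  invariant under cyclic rotation of products.\<close>

lemma qs_mult_commute: "qs (p * q) = qs (q * p)"
  by (simp add: times_cquat_def algebra_simps)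

text \<open>Conjugation negates the imaginary coefficients and nothing else, so a fixed quaternion
  is a complex scalar.\<close>

lemma central_if_conj_fixed:
  assumes "cq_conj c = c"
  shows "c * p = p * c"
  using assms
  by (cases c) (auto simp: cq_conj_def times_cquat_def algebra_simps)

text \<open>Upgrades equalities of scalar parts, which cyclic rotation provides, to full
  equalities.\<close>

lemma conj_fixed_eqI:
  assumes "cq_conj p = p" "cq_conj q = q" "qs p = qs q"
  shows "p = q"
  using assms by (cases p; cases q) (auto simp: cq_conj_def)

section \<open>Sums over self-avoiding paths\<close>

definition paths :: "'n set \<Rightarrow> 'n list set" where
  "paths S = {g. distinct g \<and> set g \<subseteq> S \<and> g \<noteq> []}"

text \<open>The sign in each step builds the parity of a cycle into the product; a single vertex has
  weight 1.\<close>

fun walk :: "('n \<Rightarrow> 'n \<Rightarrow> 'r::ring_1) \<Rightarrow> 'n list \<Rightarrow> 'r" where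
  "walk X (i # j # g) = - X i j * walk X (j # g)"
| "walk X g = 1"

text \<open>\<open>F\<close> sees the last vertex and the unvisited indices, so that a path can be
  continued by another path sum on what is left.\<close>

definition path_sum ::
  "('n \<Rightarrow> 'n \<Rightarrow> 'r::ring_1) \<Rightarrow> ('n \<Rightarrow> 'r) \<Rightarrow> 'n set \<Rightarrow> ('n \<Rightarrow> 'n set \<Rightarrow> 'r) \<Rightarrow> 'r" where
  "path_sum X y S F = (\<Sum>g\<in>paths S. y (hd g) * walk X g * F (last g) (S - set g))"

text \<open>With commuting entries and the determinant as \<open>w\<close>, this is the bilinear
  form of the adjugate matrix, evaluated at \<open>y\<close> and \<open>z\<close>.\<close>

abbreviation path_sum2 ::
  "('n \<Rightarrow> 'n \<Rightarrow> 'r::ring_1) \<Rightarrow> ('n \<Rightarrow> 'r) \<Rightarrow> ('n \<Rightarrow> 'r) \<Rightarrow> 'n set \<Rightarrow> ('n set \<Rightarrow> 'r) \<Rightarrow> 'r" where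
  "path_sum2 X y z S w \<equiv> path_sum X y S (\<lambda>m T. z m * w T)"

lemma finite_paths: "finite S \<Longrightarrow> finite (paths S)"
  unfolding paths_def using finite_subset_distinct[of S]
  by (rule rev_finite_subset) auto

lemma path_sum_empty [simp]: "path_sum X y {} F = 0"
  by (simp add: path_sum_def paths_def)

lemma paths_Diff_psubset: "g \<in> paths S \<Longrightarrow> S - set g \<subset> S"
  using hd_in_set[of g] unfolding paths_def by blast

lemma path_sum_cong:
  assumes "\<And>m T. m \<in> S \<Longrightarrow> T \<subset> S \<Longrightarrow> F m T = F' m T"
  shows "path_sum X y S F = path_sum X y S F'"
  unfolding path_sum_def
proof (rule sum.cong)
  fix g assume "g \<in> paths S"
  then have "last g \<in> S" "S - set g \<subset> S"
    using last_in_set[of g] paths_Diff_psubset by (auto simp: paths_def)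
  then show "y (hd g) * walk X g * F (last g) (S - set g) =
      y (hd g) * walk X g * F' (last g) (S - set g)"
    by (simp add: assms)
qed simp

lemma path_sum_add_right:
  "path_sum X y S (\<lambda>m T. F m T + G m T) = path_sum X y S F + path_sum X y S G"
  by (simp add: path_sum_def algebra_simps sum.distrib)

lemma path_sum_diff_right:
  "path_sum X y S (\<lambda>m T. F m T - G m T) = path_sum X y S F - path_sum X y S G"
  by (simp add: path_sum_def algebra_simps sum_subtractf)

lemma path_sum_mult_right:
  "path_sum X y S (\<lambda>m T. F m T * c) = path_sum X y S F * c"
  by (simp add: path_sum_def algebra_simps sum_distrib_right mult.assoc)

lemma path_sum_add_left:
  "path_sum X (\<lambda>j. y j + c * z j) S F = path_sum X y S F + c * path_sum X z S F"
  by (simp add: path_sum_def algebra_simps sum.distrib sum_distrib_left mult.assoc)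

lemma paths_Cons: "paths S = (\<lambda>i. [i]) ` S \<union> (\<lambda>(i, g). i # g) ` (SIGMA i:S. paths (S - {i}))"
proof (intro equalityI subsetI)
  fix g assume "g \<in> paths S"
  then show "g \<in> (\<lambda>i. [i]) ` S \<union> (\<lambda>(i, g). i # g) ` (SIGMA i:S. paths (S - {i}))"
    by (cases g; cases "tl g") (auto simp: paths_def image_iff)
qed (auto simp: paths_def)

text \<open>Deleting the first vertex \<open>i\<close> leaves a path on \<open>S - {i}\<close>
  entered through row \<open>X i\<close>; the sign of that step gives the minus. The inductions
  below rest on this recursion.\<close>

lemma path_sum_first:
  assumes "finite S"
  shows "path_sum X y S F = (\<Sum>i\<in>S. y i * (F i (S - {i}) - path_sum X (X i) (S - {i}) F))"
proof -
  let ?f = "\<lambda>g. y (hd g) * walk X g * F (last g) (S - set g)"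
  have "path_sum X y S F =
      sum ?f ((\<lambda>i. [i]) ` S) + sum ?f ((\<lambda>(i, g). i # g) ` (SIGMA i:S. paths (S - {i})))"
    unfolding path_sum_def paths_Cons[of S]
    by (rule sum.union_disjoint)
       (auto simp: assms finite_paths paths_def intro!: finite_imageI finite_SigmaI
         intro: finite_paths[unfolded paths_def])
  also have "sum ?f ((\<lambda>i. [i]) ` S) = (\<Sum>i\<in>S. y i * F i (S - {i}))"
    by (subst sum.reindex) (auto simp: inj_on_def)
  also have "sum ?f ((\<lambda>(i, g). i # g) ` (SIGMA i:S. paths (S - {i}))) =
      (\<Sum>(i, g)\<in>(SIGMA i:S. paths (S - {i})). ?f (i # g))"
    by (subst sum.reindex) (auto simp: inj_on_def case_prod_beta)
  also have "\<dots> = (\<Sum>i\<in>S. \<Sum>g\<in>paths (S - {i}). ?f (i # g))"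
    by (subst sum.Sigma) (auto simp: assms finite_paths)
  also have "\<dots> = (\<Sum>i\<in>S. - (y i * path_sum X (X i) (S - {i}) F))"
  proof (rule sum.cong[OF refl])
    fix i
    have "?f (i # g) = - (y i * (X i (hd g) * walk X g * F (last g) (S - {i} - set g)))"
      if path: "g \<in> paths (S - {i})" for g
    proof -
      obtain j h where g: "g = j # h"
        using path by (cases g) (auto simp: paths_def)
      have "S - set (i # g) = S - {i} - set g"
        by auto
      then show ?thesis
        by (simp add: g mult.assoc)
    qed
    then show "(\<Sum>g\<in>paths (S - {i}). ?f (i # g)) = - (y i * path_sum X (X i) (S - {i}) F)"
      unfolding path_sum_def by (simp add: sum_negf sum_distrib_left)
  qed
  finally show ?thesis
    by (simp add: algebra_simps sum_subtractf sum_negf)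
qed

text \<open>A \<open>Y\<close>-path is cut at its first perturbed step: up to \<open>m\<close> it
  uses steps of \<open>X\<close> only, then it takes \<open>v m * w j\<close> and continues from
  \<open>j\<close> as an arbitrary \<open>Y\<close>-path. No commutativity is involved.\<close>

lemma path_sum_resolvent:
  fixes X :: "'n \<Rightarrow> 'n \<Rightarrow> 'r::ring_1" and v w :: "'n \<Rightarrow> 'r"
  defines "Y \<equiv> \<lambda>i j. X i j + v i * w j"
  assumes "finite S"
  shows "path_sum Y y S F = path_sum X y S (\<lambda>m T. F m T - v m * path_sum Y w T F)"
  using assms(2)
proof (induction "card S" arbitrary: S y rule: less_induct)
  case less
  let ?F = "\<lambda>m T. F m T - v m * path_sum Y w T F"
  have "path_sum Y y S F = (\<Sum>i\<in>S. y i * (F i (S - {i}) - path_sum Y (Y i) (S - {i}) F))"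
    by (rule path_sum_first[OF less.prems])
  also have "\<dots> = (\<Sum>i\<in>S. y i * (?F i (S - {i}) - path_sum X (X i) (S - {i}) ?F))"
  proof (rule sum.cong[OF refl])
    fix i assume i: "i \<in> S"
    have "path_sum Y (Y i) (S - {i}) F =
        path_sum Y (X i) (S - {i}) F + v i * path_sum Y w (S - {i}) F"
      unfolding Y_def by (rule path_sum_add_left)
    also have "path_sum Y (X i) (S - {i}) F = path_sum X (X i) (S - {i}) ?F"
      using less.prems i by (intro less.hyps psubset_card_mono) auto
    finally show "y i * (F i (S - {i}) - path_sum Y (Y i) (S - {i}) F) =
        y i * (?F i (S - {i}) - path_sum X (X i) (S - {i}) ?F)"
      by (simp add: algebra_simps)
  qed
  also have "\<dots> = path_sum X y S ?F"
    by (rule path_sum_first[OF less.prems, symmetric])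
  finally show ?case .
qed

text \<open>Paths are sorted by their visit to \<open>a\<close>: they start there, reach it from
  some \<open>m\<close>, or avoid it. After \<open>a\<close> a path either stops or goes on through
  row \<open>X a\<close>.\<close>

lemma path_sum_insert:
  assumes "finite U" "a \<notin> U"
  shows "path_sum X y (insert a U) F =
    y a * (F a U - path_sum X (X a) U F) +
    path_sum X y U (\<lambda>m T. F m (insert a T) - X m a * (F a T - path_sum X (X a) T F))"
  using assms
proof (induction "card U" arbitrary: U y rule: less_induct)
  case less
  let ?F = "\<lambda>m T. F m (insert a T) - X m a * (F a T - path_sum X (X a) T F)"
  have "path_sum X y (insert a U) F =
      y a * (F a U - path_sum X (X a) U F) +
      (\<Sum>i\<in>U. y i * (F i (insert a U - {i}) - path_sum X (X i) (insert a U - {i}) F))"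
    using less.prems by (subst path_sum_first) auto
  also have "(\<Sum>i\<in>U. y i * (F i (insert a U - {i}) - path_sum X (X i) (insert a U - {i}) F)) =
      (\<Sum>i\<in>U. y i * (?F i (U - {i}) - path_sum X (X i) (U - {i}) ?F))"
  proof (rule sum.cong[OF refl])
    fix i assume i: "i \<in> U"
    then have *: "insert a U - {i} = insert a (U - {i})"
      using less.prems by auto
    have IH: "path_sum X (X i) (insert a (U - {i})) F =
        X i a * (F a (U - {i}) - path_sum X (X a) (U - {i}) F) +
        path_sum X (X i) (U - {i}) ?F"
      using less.prems i by (intro less.hyps psubset_card_mono) auto
    show "y i * (F i (insert a U - {i}) - path_sum X (X i) (insert a U - {i}) F) =
        y i * (?F i (U - {i}) - path_sum X (X i) (U - {i}) ?F)"
      unfolding * IH by (simp add: algebra_simps del: insert_Diff_single)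
  qed
  also have "\<dots> = path_sum X y U ?F"
    by (rule path_sum_first[OF less.prems(1), symmetric])
  finally show ?case .
qed

section \<open>Exchanging two disjoint paths\<close>

lemma sum_disjoint_paths_swap:
  assumes "finite S"
  shows "(\<Sum>g\<in>paths S. \<Sum>h\<in>paths (S - set g). f g h) =
    (\<Sum>g\<in>paths S. \<Sum>h\<in>paths (S - set g). f h g)"
  by (subst (1 2) sum.Sigma)
     (auto simp: assms finite_paths paths_def intro: finite_paths[unfolded paths_def]
       intro!: sum.reindex_bij_witness[of _ prod.swap prod.swap])

lemma path_sum_path_sum:
  "path_sum X y S (\<lambda>m T. z m * path_sum X y' T F) =
    (\<Sum>g\<in>paths S. \<Sum>h\<in>paths (S - set g).
      y (hd g) * walk X g * z (last g) * (y' (hd h) * walk X h * F (last h) (S - set g - set h)))"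
  by (simp add: path_sum_def sum_distrib_left mult.assoc)

text \<open>Both sides sum over ordered pairs of disjoint paths. The inner sum, being central, moves
  in front of the outer path; then the two paths trade roles, and \<open>w\<close> returns to the
  far right.\<close>

lemma path_sum2_swap:
  fixes X :: "'n \<Rightarrow> 'n \<Rightarrow> 'r::ring_1"
  assumes S: "finite S"
    and w: "\<And>T p. T \<subset> S \<Longrightarrow> w T * p = p * w T"
    and central: "\<And>T p. T \<subset> S \<Longrightarrow> path_sum2 X y z T w * p = p * path_sum2 X y z T w"
  shows "path_sum2 X y' z' S (\<lambda>T. path_sum2 X y z T w) =
    path_sum2 X y z S (\<lambda>T. path_sum2 X y' z' T w)"
proof -
  have proper: "S - set g \<subset> S" "S - set g - set h \<subset> S" if "g \<in> paths S" for g h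
    using paths_Diff_psubset[OF that] by auto
  have "path_sum2 X y' z' S (\<lambda>T. path_sum2 X y z T w) =
      (\<Sum>g\<in>paths S. path_sum2 X y z (S - set g) w * (y' (hd g) * walk X g * z' (last g)))"
    unfolding path_sum_def[of X y' S]
    by (intro sum.cong refl) (simp add: central[OF proper(1)] mult.assoc)
  also have "\<dots> = (\<Sum>g\<in>paths S. \<Sum>h\<in>paths (S - set g).
      y (hd h) * walk X h * z (last h) *
        (y' (hd g) * walk X g * (z' (last g) * w (S - set h - set g))))"
  proof (intro sum.cong refl)
    fix g assume g: "g \<in> paths S"
    have "y (hd h) * walk X h * (z (last h) * w (S - set g - set h)) *
        (y' (hd g) * walk X g * z' (last g)) =
        y (hd h) * walk X h * z (last h) *
        (y' (hd g) * walk X g * (z' (last g) * w (S - set h - set g)))" for h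
    proof -
      have "S - set g - set h = S - set h - set g"
        by auto
      then show ?thesis
        using w[OF proper(2)[OF g, of h], of "y' (hd g) * walk X g * z' (last g)"]
        by (simp add: mult.assoc)
    qed
    then show "path_sum2 X y z (S - set g) w * (y' (hd g) * walk X g * z' (last g)) =
      (\<Sum>h\<in>paths (S - set g). y (hd h) * walk X h * z (last h) *
        (y' (hd g) * walk X g * (z' (last g) * w (S - set h - set g))))"
      by (simp add: path_sum_def sum_distrib_right)
  qed
  also have "\<dots> = path_sum2 X y z S (\<lambda>T. path_sum2 X y' z' T w)"
    unfolding path_sum_path_sum by (rule sum_disjoint_paths_swap[OF S])
  finally show ?thesis .
qed

text \<open>Without centrality of a path sum the two path weights can still be rotated past each
  other under the trace \<open>qs\<close>.\<close>

lemma qs_path_sum2_swap: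
  assumes S: "finite S" and w: "\<And>T p. T \<subset> S \<Longrightarrow> w T * p = p * w T"
  shows "qs (path_sum2 X y z S (\<lambda>T. path_sum2 X y' z' T w)) =
    qs (path_sum2 X y' z' S (\<lambda>T. path_sum2 X y z T w))"
  unfolding path_sum_path_sum qs_sum
proof (subst sum_disjoint_paths_swap[OF S], intro sum.cong refl)
  fix g h assume g: "g \<in> paths S"
  let ?p = "y (hd h) * walk X h * z (last h)" and ?q = "y' (hd g) * walk X g * z' (last g)"
  have *: "S - set h - set g = S - set g - set h" "S - set g - set h \<subset> S"
    using paths_Diff_psubset[OF g] by auto
  have "qs (?p * (?q * w (S - set g - set h))) = qs (?q * w (S - set g - set h) * ?p)"
    by (rule qs_mult_commute)
  then show "qs (?p * (y' (hd g) * walk X g * (z' (last g) * w (S - set h - set g)))) =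
      qs (?q * (y (hd h) * walk X h * (z (last h) * w (S - set g - set h))))"
    using w[OF *(2), of ?p] by (simp add: *(1) mult.assoc)
qed

section \<open>Duality as reversal of paths\<close>

lemma walk_snoc: "g \<noteq> [] \<Longrightarrow> walk X (g @ [j]) = walk X g * - X (last g) j"
  by (induction X g rule: walk.induct) (simp_all add: mult.assoc)

lemma cq_conj_walk:
  assumes "\<And>i j. cq_conj (X i j) = X j i"
  shows "cq_conj (walk X g) = walk X (rev g)"
proof (induction X\<equiv>X g rule: walk.induct)
  case (1 i j g)
  then show ?case
    using assms walk_snoc[of "rev g @ [j]" X i] by (simp add: cq_conj_mult cq_conj_minus)
qed simp_all

text \<open>Reversing every path is a bijection of \<open>paths S\<close> that keeps the vertex set;
  it exchanges the two end weights, and the scalar \<open>w\<close> moves back to the right.\<close>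

lemma cq_conj_path_sum2:
  assumes X: "\<And>i j. cq_conj (X i j) = X j i"
    and w: "\<And>T. T \<subset> S \<Longrightarrow> cq_conj (w T) = w T"
  shows "cq_conj (path_sum2 X y z S w) = path_sum2 X (\<lambda>i. cq_conj (z i)) (\<lambda>i. cq_conj (y i)) S w"
proof -
  have "cq_conj (path_sum2 X y z S w) = (\<Sum>g\<in>paths S.
      cq_conj (y (hd g) * walk X g * (z (last g) * w (S - set g))))"
    by (simp add: path_sum_def cq_conj_sum)
  also have "\<dots> = (\<Sum>g\<in>paths S.
      cq_conj (z (hd g)) * walk X g * (cq_conj (y (last g)) * w (S - set g)))"
  proof (rule sum.reindex_bij_witness[of _ rev rev])
    fix g assume g: "g \<in> paths S"
    then have w': "cq_conj (w (S - set g)) = w (S - set g)"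
      by (intro w paths_Diff_psubset)
    show "cq_conj (z (hd (rev g))) * walk X (rev g) * (cq_conj (y (last (rev g))) * w (S - set (rev g))) =
        cq_conj (y (hd g) * walk X g * (z (last g) * w (S - set g)))"
      using g by (simp add: cq_conj_mult cq_conj_walk[OF X] w' hd_rev last_rev paths_def mult.assoc
         central_if_conj_fixed[OF w'])
  qed (auto simp: paths_def)
  finally show ?thesis
    by (simp add: path_sum_def)
qed

section \<open>Expansion of the Moore--Dyson determinant\<close>

text \<open>Arbitrary index sets are allowed here because deleting a path from an initial segment
  need not leave an initial segment.\<close>

definition cycle_tops :: "nat set \<Rightarrow> (nat \<Rightarrow> nat) \<Rightarrow> nat set" where
  "cycle_tops S \<sigma> = {a \<in> S. \<forall>b \<in> set (support \<sigma> a). b \<le> a}"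

definition moore_term :: "(nat \<Rightarrow> nat \<Rightarrow> cquat) \<Rightarrow> nat set \<Rightarrow> (nat \<Rightarrow> nat) \<Rightarrow> cquat" where
  "moore_term X S \<sigma> = (- 1) ^ (card S - card (cycle_tops S \<sigma>)) *
     prod_list (map (cycle_prod X \<sigma>) (rev (sorted_list_of_set (cycle_tops S \<sigma>))))"

definition moore_det :: "(nat \<Rightarrow> nat \<Rightarrow> cquat) \<Rightarrow> nat set \<Rightarrow> cquat" where
  "moore_det X S = (\<Sum>\<sigma> | \<sigma> permutes S. moore_term X S \<sigma>)"

lemma DetM_eq_moore_det: "DetM n X = moore_det X {..<n}"
  by (simp add: DetM_def moore_det_def moore_term_def cycle_maxima_def cycle_tops_def)

lemma moore_det_empty [simp]: "moore_det X {} = 1"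
  by (simp add: moore_det_def moore_term_def cycle_tops_def permutes_empty)

text \<open>The list \<open>a # g @ [b]\<close> has \<open>Suc (length g)\<close> steps, each with
  one minus sign in \<open>walk\<close>. The case \<open>b = a\<close> is a cycle product.\<close>

lemma prod_list_walk:
  fixes X :: "'n \<Rightarrow> 'n \<Rightarrow> 'r::ring_1"
  shows "prod_list (map2 X (a # g) (g @ [b])) = (- 1) ^ Suc (length g) * walk X (a # g @ [b])"
proof (induction g arbitrary: a)
  case (Cons c g)
  have "X a c * ((- 1) ^ n * p) = (- 1) ^ n * (X a c * p)" for n and p :: 'r
    by (cases "even n") simp_all
  then show ?case
    using Cons[of c] by simp
qed simp

lemma support_cong:
  assumes "\<And>y. y \<in> A \<Longrightarrow> f y = h y" "\<And>y. y \<in> A \<Longrightarrow> h y \<in> A" "x \<in> A"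
  shows "support f x = support h x" "set (support h x) \<subseteq> A"
proof -
  have *: "(f ^^ n) x = (h ^^ n) x \<and> (h ^^ n) x \<in> A" for n
    using assms by (induction n) auto
  then show "support f x = support h x" "set (support h x) \<subseteq> A"
    by (auto simp: least_power_def)
qed

lemma self_in_support: "permutation p \<Longrightarrow> x \<in> set (support p x)"
  unfolding support_set by (rule range_eqI[of _ _ 0]) simp

section \<open>Permutations with a prescribed cycle through the largest index\<close>

context
  fixes a :: nat and U :: "nat set" and g :: "nat list" and \<tau> :: "nat \<Rightarrow> nat"
  assumes U: "finite U" "\<And>x. x \<in> U \<Longrightarrow> x < a"
    and g: "distinct g" "set g \<subseteq> U"
    and \<tau>: "\<tau> permutes U - set g"
begin

private definition \<sigma> :: "nat \<Rightarrow> nat" where "\<sigma> = cycle_of_list (a # g) \<circ> \<tau>"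

private lemma a_notin: "a \<notin> U"
  using U(2) by blast

private lemma dist: "distinct (a # g)"
  using g a_notin by auto

private lemma outside: "x \<notin> set (a # g) \<Longrightarrow> \<sigma> x = \<tau> x"
  using permutes_in_image[OF \<tau>, of x] permutes_not_in[OF \<tau>, of x] g a_notin
  by (cases "x \<in> U - set g") (auto simp: \<sigma>_def intro!: id_outside_supp)

private lemma inside: "x \<in> set (a # g) \<Longrightarrow> \<sigma> x = cycle_of_list (a # g) x"
  using permutes_not_in[OF \<tau>, of x] a_notin by (auto simp: \<sigma>_def)

lemma cycle_extension_permutes: "cycle_of_list (a # g) \<circ> \<tau> permutes insert a U"
proof (rule permutes_compose)
  show "\<tau> permutes insert a U"
    by (rule permutes_subset[OF \<tau>]) auto
  show "cycle_of_list (a # g) permutes insert a U"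
    by (rule permutes_subset[OF cycle_permutes]) (use g in auto)
qed

private lemma permutation_\<sigma>: "permutation \<sigma>"
  unfolding \<sigma>_def using U(1) cycle_extension_permutes
  by (intro permutes_imp_permutation[of "insert a U"]) auto

private lemma funpow_\<sigma>: "(\<sigma> ^^ n) a = (a # g) ! (n mod length (a # g))"
proof -
  have "(\<sigma> ^^ n) a = (cycle_of_list (a # g) ^^ n) a \<and> (\<sigma> ^^ n) a \<in> set (a # g)"
  proof (induction n)
    case (Suc n)
    have "\<sigma> ((\<sigma> ^^ n) a) = cycle_of_list (a # g) ((\<sigma> ^^ n) a)"
      using Suc by (intro inside) blast
    moreover have "cycle_of_list (a # g) ((\<sigma> ^^ n) a) \<in> set (a # g)"
      using Suc cycle_is_surj[OF dist] by blast
    ultimately show ?case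
      using Suc by (simp del: cycle_of_list.simps list.set)
  qed simp
  moreover have "map (cycle_of_list (a # g) ^^ n) (a # g) ! 0 = (a # g) ! (n mod length (a # g))"
    unfolding cyclic_rotation[OF dist] by (subst nth_rotate) simp_all
  ultimately show ?thesis
    by simp
qed

lemma cycle_extension_support: "support (cycle_of_list (a # g) \<circ> \<tau>) a = a # g"
proof -
  let ?n = "length (a # g)"
  have "least_power \<sigma> a = ?n"
    unfolding least_power_def
  proof (rule Least_equality)
    show "(\<sigma> ^^ ?n) a = a \<and> 0 < ?n"
      by (simp add: funpow_\<sigma> del: funpow.simps)
    fix m assume m: "(\<sigma> ^^ m) a = a \<and> 0 < m"
    show "?n \<le> m"
    proof (rule ccontr)
      assume "\<not> ?n \<le> m"
      then have "(a # g) ! m = (a # g) ! 0"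
        using m funpow_\<sigma>[of m] by simp
      then show False
        using nth_eq_iff_index_eq[OF dist, of m 0] m \<open>\<not> ?n \<le> m\<close> by simp
    qed
  qed
  then have "support \<sigma> a = map ((!) (a # g)) [0..<?n]"
    by (simp add: funpow_\<sigma> del: upt_Suc)
  then show ?thesis
    unfolding map_nth by (simp add: \<sigma>_def)
qed

lemma cycle_extension_outside: "x \<notin> set (a # g) \<Longrightarrow> (cycle_of_list (a # g) \<circ> \<tau>) x = \<tau> x"
  using outside by (simp add: \<sigma>_def)

private lemma support_outside:
  assumes "x \<in> U - set g"
  shows "support \<sigma> x = support \<tau> x" "set (support \<tau> x) \<subseteq> U - set g"
proof -
  have *: "\<sigma> y = \<tau> y" "\<tau> y \<in> U - set g" if "y \<in> U - set g" for y
    using outside[of y] that a_notin permutes_in_image[OF \<tau>, of y] by auto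
  show "support \<sigma> x = support \<tau> x"
    by (rule support_cong(1)[where A = "U - set g"]) (use * assms in auto)
  show "set (support \<tau> x) \<subseteq> U - set g"
    by (rule support_cong(2)[where A = "U - set g" and f = \<sigma>]) (use * assms in auto)
qed

text \<open>The vertices of \<open>g\<close> lie in the cycle of \<open>a\<close>, whose top is
  \<open>a\<close>; all other cycles are those of \<open>\<tau>\<close>.\<close>

private lemma cycle_tops_\<sigma>: "cycle_tops (insert a U) \<sigma> = insert a (cycle_tops (U - set g) \<tau>)"
proof -
  have "a \<in> cycle_tops (insert a U) \<sigma>"
    unfolding cycle_tops_def \<sigma>_def mem_Collect_eq cycle_extension_support
    using U g by (auto intro: less_imp_le)
  moreover have "x \<notin> cycle_tops (insert a U) \<sigma>" if "x \<in> set g" for x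
  proof
    assume x: "x \<in> cycle_tops (insert a U) \<sigma>"
    have "x \<in> set (support \<sigma> a)"
      unfolding \<sigma>_def cycle_extension_support using that by simp
    then have "a \<in> set (support \<sigma> x)"
      using disjoint_support'[OF permutation_\<sigma>, of a x] self_in_support[OF permutation_\<sigma>, of x]
      by blast
    then have "a \<le> x"
      using x unfolding cycle_tops_def by blast
    then show False
      using that g U(2)[of x] by auto
  qed
  moreover have "x \<in> cycle_tops (insert a U) \<sigma> \<longleftrightarrow> x \<in> cycle_tops (U - set g) \<tau>"
    if "x \<in> U - set g" for x
    unfolding cycle_tops_def mem_Collect_eq support_outside(1)[OF that] using that by blast
  moreover have "cycle_tops (U - set g) \<tau> \<subseteq> U - set g" "cycle_tops (insert a U) \<sigma> \<subseteq> insert a U"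
    by (auto simp: cycle_tops_def)
  ultimately show ?thesis
    by blast
qed

private lemma cycle_prod_\<sigma>:
  "cycle_prod X \<sigma> a = (- 1) ^ Suc (length g) * walk X (a # g @ [a])"
proof -
  have supp: "support \<sigma> a = a # g"
    using cycle_extension_support by (simp add: \<sigma>_def)
  have "map \<sigma> (a # g) = map (cycle_of_list (a # g)) (a # g)"
    by (rule map_cong[OF refl]) (rule inside)
  also have "\<dots> = g @ [a]"
    using cyclic_rotation[OF dist, of 1] by (simp del: cycle_of_list.simps)
  finally have "map \<sigma> (a # g) = g @ [a]" .
  moreover have "map2 X h (map \<sigma> h) = map (\<lambda>i. X i (\<sigma> i)) h" for h
    by (induction h) simp_all
  ultimately have "map2 X (a # g) (g @ [a]) = map (\<lambda>i. X i (\<sigma> i)) (a # g)"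
    by metis
  then show ?thesis
    unfolding cycle_prod_def supp by (metis prod_list_walk)
qed

text \<open>Tops are listed in decreasing order, so the cycle of the largest index \<open>a\<close>
  is the leftmost factor. Its parity \<open>length g\<close> and the \<open>Suc (length g)\<close>
  signs of the walk leave a single minus.\<close>

lemma moore_term_cycle_extension:
  "moore_term X (insert a U) (cycle_of_list (a # g) \<circ> \<tau>) =
    - walk X (a # g @ [a]) * moore_term X (U - set g) \<tau>"
proof -
  let ?C = "cycle_tops (U - set g) \<tau>"
  have C: "?C \<subseteq> U - set g"
    by (auto simp: cycle_tops_def)
  then have fin: "finite ?C" and le: "card ?C \<le> card (U - set g)" and aC: "a \<notin> ?C"
    using U(1) a_notin by (auto intro: finite_subset card_mono)
  have card_U: "card (U - set g) + length g = card U"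
    using U(1) g by (simp add: card_Diff_subset distinct_card card_mono flip: distinct_card)
  have "cycle_prod X \<sigma> x = cycle_prod X \<tau> x" if "x \<in> ?C" for x
  proof -
    have x: "x \<in> U - set g"
      using that C by blast
    have "X i (\<sigma> i) = X i (\<tau> i)" if "i \<in> set (support \<tau> x)" for i
      using that support_outside(2)[OF x] outside[of i] a_notin by fastforce
    then show ?thesis
      unfolding cycle_prod_def support_outside(1)[OF x]
      by (intro arg_cong[where f = prod_list] map_cong refl)
  qed
  then have map_eq: "map (cycle_prod X \<sigma>) (rev (sorted_list_of_set ?C)) =
      map (cycle_prod X \<tau>) (rev (sorted_list_of_set ?C))"
    using fin by simp
  have sign: "(- 1) ^ (m + l) * ((- 1) ^ Suc l * p * q) = - p * ((- 1) ^ m * q)"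
    for m l and p q :: cquat
    by (cases "even m"; cases "even l") (simp_all add: mult.assoc)
  have "card (insert a U) - card (insert a ?C) = card (U - set g) - card ?C + length g"
    using card_U le fin aC U(1) a_notin by simp
  moreover have "sorted_list_of_set (insert a ?C) = sorted_list_of_set ?C @ [a]"
    using fin aC C U(2)
    by (subst sorted_list_of_set_insert)
       (auto intro!: sorted_insort_is_snoc less_imp_le)
  ultimately show ?thesis
    unfolding moore_term_def \<sigma>_def[symmetric] cycle_tops_\<sigma>
    by (simp only: cycle_prod_\<sigma> map_eq rev.simps rev_append append.simps list.map prod_list.Cons sign)
qed

end

text \<open>A permutation of \<open>insert a U\<close> is the cycle of \<open>a\<close> together
  with a permutation of the rest. The outcome is the bordered determinant formula, row
  \<open>a\<close> and column \<open>a\<close> being paired by the adjugate.\<close>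

lemma moore_det_insert_Max:
  assumes U: "finite U" "\<And>x. x \<in> U \<Longrightarrow> x < a"
  shows "moore_det X (insert a U) =
    X a a * moore_det X U - path_sum2 X (X a) (\<lambda>m. X m a) U (moore_det X)"
proof -
  let ?L = "{g. distinct g \<and> set g \<subseteq> U}"
  have a: "a \<notin> U"
    using U(2) by blast
  \<comment> \<open>The empty list is the case of a fixed point \<open>a\<close>, which yields the
    term with \<open>X a a\<close>.\<close>
  have L: "?L = insert [] (paths U)" "[] \<notin> paths U"
    by (auto simp: paths_def)
  \<comment> \<open>\<open>glue\<close> and \<open>cut\<close> are mutually inverse:
    \<open>cut\<close> reads the cycle of \<open>a\<close> off its support and replaces the
    permutation by the identity there.\<close>
  define glue where "glue = (\<lambda>(g, \<tau> :: nat \<Rightarrow> nat). cycle_of_list (a # g) \<circ> \<tau>)"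
  define cut where "cut = (\<lambda>\<sigma>. (tl (support \<sigma> a),
    \<lambda>x. if x \<in> insert a U - set (support \<sigma> a) then \<sigma> x else x))"
  define P where "P = (SIGMA g:?L. {\<tau>. \<tau> permutes U - set g})"
  define t where "t = (\<lambda>(g, \<tau>). - walk X (a # g @ [a]) * moore_term X (U - set g) \<tau>)"
  have glue: "glue (g, \<tau>) permutes insert a U" "cut (glue (g, \<tau>)) = (g, \<tau>)"
      "t (g, \<tau>) = moore_term X (insert a U) (glue (g, \<tau>))" if "(g, \<tau>) \<in> P" for g \<tau>
  proof -
    have g: "distinct g" "set g \<subseteq> U" and \<tau>: "\<tau> permutes U - set g"
      using that by (auto simp: P_def)
    show "glue (g, \<tau>) permutes insert a U"
      using cycle_extension_permutes[OF U g \<tau>] by (simp add: glue_def)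
    have supp: "support (cycle_of_list (a # g) \<circ> \<tau>) a = a # g"
      by (rule cycle_extension_support[OF U g \<tau>])
    have "(\<lambda>x. if x \<in> insert a U - set (a # g) then (cycle_of_list (a # g) \<circ> \<tau>) x else x) = \<tau>"
    proof
      fix x
      show "(if x \<in> insert a U - set (a # g) then (cycle_of_list (a # g) \<circ> \<tau>) x else x) = \<tau> x"
        using cycle_extension_outside[OF U g \<tau>, of x] permutes_not_in[OF \<tau>, of x] a
        by (cases "x \<in> insert a U - set (a # g)") auto
    qed
    then show "cut (glue (g, \<tau>)) = (g, \<tau>)"
      unfolding cut_def glue_def prod.case supp by (simp only: list.sel)
    show "t (g, \<tau>) = moore_term X (insert a U) (glue (g, \<tau>))"
      unfolding t_def glue_def prod.case by (rule moore_term_cycle_extension[OF U g \<tau>, symmetric])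
  qed
  have cut: "cut \<sigma> \<in> P" "glue (cut \<sigma>) = \<sigma>" if \<sigma>: "\<sigma> permutes insert a U" for \<sigma>
  proof -
    have perm: "permutation \<sigma>"
      using \<sigma> U(1) by (intro permutes_imp_permutation[of "insert a U"]) auto
    define \<tau> where "\<tau> = (\<lambda>x. if x \<in> insert a U - set (support \<sigma> a) then \<sigma> x else x)"
    define g where "g = tl (support \<sigma> a)"
    have supp: "support \<sigma> a = a # g"
      unfolding g_def using least_power_of_permutation(2)[OF perm, of a]
      by (simp add: upt_conv_Cons)
    have cut: "cut \<sigma> = (g, \<tau>)"
      unfolding cut_def g_def \<tau>_def ..
    have dist: "distinct g" "a \<notin> set g"
      using cycle_of_permutation[OF perm, of a] unfolding supp by auto
    have "(\<sigma> ^^ n) a \<in> insert a U" for n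
      using permutes_in_image[OF permutes_funpow[OF \<sigma>]] by blast
    then have "set (a # g) \<subseteq> insert a U"
      unfolding supp[symmetric] by auto
    then have gU: "set g \<subseteq> U"
      using dist by auto
    have "insert a U - set (a # g) = U - set g"
      using a by auto
    then have \<tau>: "\<tau> permutes U - set g"
      using semidecomposition[OF \<sigma>, of a] U(1) unfolding \<tau>_def supp by simp
    show "cut \<sigma> \<in> P"
      unfolding P_def cut using \<tau> gU dist by simp
    have "(cycle_of_list (a # g) \<circ> \<tau>) x = \<sigma> x" for x
    proof (cases "x \<in> set (a # g)")
      case True
      then have "\<tau> x = x"
        unfolding \<tau>_def supp by simp
      then show ?thesis
        using True cycle_restrict[OF perm, of x a] unfolding supp
        by (simp del: cycle_of_list.simps)
    next
      case False
      have "\<tau> x = \<sigma> x"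
        using False permutes_not_in[OF \<sigma>, of x] unfolding \<tau>_def supp by simp
      then show ?thesis
        using cycle_extension_outside[OF U dist(1) gU \<tau> False] by simp
    qed
    then show "glue (cut \<sigma>) = \<sigma>"
      unfolding cut glue_def prod.case by (rule ext)
  qed
  have "t (cut \<sigma>) = moore_term X (insert a U) \<sigma>" if "\<sigma> permutes insert a U" for \<sigma>
    using glue(3)[of "fst (cut \<sigma>)" "snd (cut \<sigma>)"] cut[OF that] by simp
  then have "moore_det X (insert a U) = sum t P"
    unfolding moore_det_def using glue(1,2) cut
    by (intro sum.reindex_bij_witness[of _ glue cut]) auto
  also have "\<dots> = (\<Sum>g\<in>?L. - walk X (a # g @ [a]) * moore_det X (U - set g))"
    unfolding moore_det_def sum_distrib_left P_def t_def
    by (rule sum.Sigma[symmetric])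
       (use U in \<open>auto simp: L finite_paths intro: finite_permutations\<close>)
  also have "\<dots> = X a a * moore_det X U +
      (\<Sum>g\<in>paths U. - walk X (a # g @ [a]) * moore_det X (U - set g))"
    using L(2) finite_paths[OF U(1)] unfolding L(1) by simp
  also have "(\<Sum>g\<in>paths U. - walk X (a # g @ [a]) * moore_det X (U - set g)) =
      (\<Sum>g\<in>paths U. - (X a (hd g) * walk X g * (X (last g) a * moore_det X (U - set g))))"
  proof (rule sum.cong[OF refl])
    fix g assume "g \<in> paths U"
    then have "g \<noteq> []"
      by (simp add: paths_def)
    then have "walk X (a # g @ [a]) = X a (hd g) * (walk X g * X (last g) a)"
      by (cases g) (use walk_snoc[of g X a] in simp_all)
    then show "- walk X (a # g @ [a]) * moore_det X (U - set g) =
        - (X a (hd g) * walk X g * (X (last g) a * moore_det X (U - set g)))"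
      by (simp add: mult.assoc)
  qed
  finally show ?thesis
    by (simp add: path_sum_def sum_negf)
qed

section \<open>Rank-one perturbations\<close>

lemma finite_Max_insertE:
  fixes S :: "'n::linorder set"
  assumes "finite S" "S \<noteq> {}"
  obtains a U where "S = insert a U" "finite U" "\<And>x. x \<in> U \<Longrightarrow> x < a" "card U < card S"
proof (rule that[of "Max S" "S - {Max S}"])
  show "S = insert (Max S) (S - {Max S})"
    using Max_in[OF assms] by auto
  show "x < Max S" if "x \<in> S - {Max S}" for x
    using that Max_ge[OF assms(1), of x] by auto
  show "card (S - {Max S}) < card S"
    by (rule card_Diff1_less[OF assms(1) Max_in[OF assms]])
qed (use assms in simp)

text \<open>In the bordered expansion, \<open>X a a\<close> and the smaller determinant are fixed
  scalars, and reversing paths turns row \<open>a\<close> into column \<open>a\<close>, so the path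
  sum is fixed as well.\<close>

lemma cq_conj_moore_det:
  assumes X: "\<And>i j. cq_conj (X i j) = X j i" and "finite S"
  shows "cq_conj (moore_det X S) = moore_det X S"
  using assms(2)
proof (induction "card S" arbitrary: S rule: less_induct)
  case less
  show ?case
  proof (cases "S = {}")
    case False
    obtain a U where S: "S = insert a U"
      and U: "finite U" "\<And>x. x \<in> U \<Longrightarrow> x < a" and card: "card U < card S"
      using finite_Max_insertE[OF less.prems False] by blast
    have IH: "cq_conj (moore_det X T) = moore_det X T" if "T \<subseteq> U" for T
      using that U(1) card card_mono[OF U(1) that] by (intro less.hyps) (auto intro: finite_subset)
    have "cq_conj (path_sum2 X (X a) (\<lambda>m. X m a) U (moore_det X)) =
        path_sum2 X (X a) (\<lambda>m. X m a) U (moore_det X)"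
      using IH by (subst cq_conj_path_sum2) (auto simp: X)
    then show ?thesis
      using central_if_conj_fixed[OF X, of a "moore_det X U"] IH[of U]
      unfolding S by (simp add: moore_det_insert_Max[OF U] cq_conj_diff cq_conj_mult X)
  qed simp
qed

section \<open>The matrix determinant lemma for self-dual quaternion matrices\<close>

context
  fixes X :: "nat \<Rightarrow> nat \<Rightarrow> cquat" and v :: "nat \<Rightarrow> cquat"
  assumes X: "\<And>i j. cq_conj (X i j) = X j i"
begin

private definition w :: "nat \<Rightarrow> cquat" where "w i = cq_conj (v i)"

private definition Y :: "cquat \<Rightarrow> nat \<Rightarrow> nat \<Rightarrow> cquat" where
  "Y c = (\<lambda>i j. X i j + (c * v i) * w j)"

private abbreviation D :: "nat set \<Rightarrow> cquat" where "D \<equiv> moore_det X"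

text \<open>The candidate for the coefficient of \<open>c\<close>; for commuting entries it is v*
  adj(X) v.\<close>

private definition G :: "nat set \<Rightarrow> cquat" where "G T = path_sum2 X w v T D"

private lemma cq_conj_Y: "cq_conj c = c \<Longrightarrow> cq_conj (Y c i j) = Y c j i"
  using central_if_conj_fixed[of c "v j * w i"]
  by (simp add: Y_def w_def X cq_conj_add cq_conj_mult mult.assoc)

private lemma D_fixed: "finite T \<Longrightarrow> cq_conj (D T) = D T"
  by (rule cq_conj_moore_det[OF X])

private lemma G_fixed: "finite T \<Longrightarrow> cq_conj (G T) = G T"
proof -
  assume T: "finite T"
  have "cq_conj (path_sum2 X w v T D) = path_sum2 X (\<lambda>i. cq_conj (v i)) (\<lambda>i. cq_conj (w i)) T D"
    using T by (intro cq_conj_path_sum2[OF X] D_fixed) (auto intro: finite_subset)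
  then show ?thesis
    by (simp add: G_def w_def[abs_def])
qed

private lemmas D_central = central_if_conj_fixed[OF D_fixed]
private lemmas G_central = central_if_conj_fixed[OF G_fixed]

context
  fixes a :: nat and U :: "nat set"
  assumes U: "finite U" "\<And>x. x \<in> U \<Longrightarrow> x < a"
begin

private definition xa :: "nat \<Rightarrow> cquat" where "xa m = X m a"
text \<open>\<open>C\<close>, \<open>R\<close> and \<open>L\<close> pair row \<open>a\<close> or
  \<open>w\<close> with column \<open>a\<close> or \<open>v\<close> through paths avoiding
  \<open>a\<close>; removing \<open>a\<close> from the index set leaves such pieces.\<close>

private definition C :: "nat set \<Rightarrow> cquat" where "C T = path_sum2 X (X a) xa T D"
private definition R :: "nat set \<Rightarrow> cquat" where "R T = path_sum2 X w xa T D"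
private definition L :: "nat set \<Rightarrow> cquat" where "L T = path_sum2 X (X a) v T D"
text \<open>What remains as coefficient of \<open>c\<close> in the bordered expansion of the
  perturbed determinant; the bracket comes from paths entered through the unperturbed row
  \<open>X a\<close>.\<close>

private definition k :: cquat where
  "k = X a a * G U + v a * w a * D U -
    (path_sum2 X (X a) xa U G + L U * w a - path_sum2 X (X a) v U R) - v a * R U"

private lemma a_notin_U: "a \<notin> U"
  using U(2) by blast

private lemma finite_sub: "T \<subseteq> U \<Longrightarrow> finite T"
  using U(1) by (rule finite_subset[rotated])

private lemma insert_D: "T \<subseteq> U \<Longrightarrow> D (insert a T) = X a a * D T - C T"
  unfolding C_def xa_def using U by (intro moore_det_insert_Max) (auto intro: finite_sub)

private lemma C_central: "T \<subseteq> U \<Longrightarrow> C T * p = p * C T"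
  unfolding C_def using X
  by (intro central_if_conj_fixed, subst cq_conj_path_sum2)
     (auto simp: xa_def intro!: D_fixed finite_sub)

text \<open>
  \<open>Y_sub\<close> and \<open>Y_col\<close> say that the path sums entering the expansion along the cycle of \<open>a\<close> are
  unchanged by the perturbation; this is what removes the higher powers of \<open>c\<close>.
\<close>

private lemma expansion:
  assumes c: "cq_conj c = c"
    and IH: "\<And>T. T \<subseteq> U \<Longrightarrow> moore_det (Y c) T = D T + c * G T"
  shows "moore_det (Y c) (insert a U) = D (insert a U) + c * k"
proof -
  note c_comm = central_if_conj_fixed[OF c]
  have c_lcomm: "c * (p * q) = p * (c * q)" for p q
    by (metis c_comm mult.assoc)
  have Y_sub: "path_sum2 (Y c) w v T (moore_det (Y c)) = G T" if "T \<subseteq> U" for T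
    using finite_sub[OF that] that
  proof (induction T rule: finite_psubset_induct)
    case (psubset T)
    have "path_sum2 (Y c) w v T (moore_det (Y c)) = path_sum X w T
        (\<lambda>m R. v m * moore_det (Y c) R - (c * v m) * path_sum2 (Y c) w v R (moore_det (Y c)))"
      unfolding Y_def by (rule path_sum_resolvent[OF psubset.hyps(1)])
    \<comment> \<open>The term with \<open>c\<close> in the perturbed determinant is cancelled, for
      each \<open>m\<close> and \<open>R\<close>, by the term that a perturbed step
      produces.\<close>
    also have "\<dots> = path_sum X w T (\<lambda>m R. v m * D R)"
    proof (rule path_sum_cong)
      fix m R assume "R \<subset> T"
      then show "v m * moore_det (Y c) R - (c * v m) * path_sum2 (Y c) w v R (moore_det (Y c)) = v m * D R"
        using psubset.IH[of R] psubset.prems IH[of R]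
        by (simp add: c_comm[of "v m"] distrib_left mult.assoc)
    qed
    finally show ?case
      by (simp add: G_def)
  qed
  \<comment> \<open>Since \<open>G\<close> is central, a path from \<open>w\<close> to column
    \<open>a\<close> and one from \<open>w\<close> to \<open>v\<close> may be exchanged.\<close>
  have swap: "path_sum2 X w xa T G = path_sum2 X w v T R" if "T \<subseteq> U" for T
    unfolding G_def R_def
    by (rule path_sum2_swap)
       (use that finite_sub[of T] in \<open>auto intro!: D_central G_central[unfolded G_def] finite_sub\<close>)
  have Y_col: "path_sum2 (Y c) w xa T (moore_det (Y c)) = R T" if "T \<subseteq> U" for T
    using finite_sub[OF that] that
  proof (induction T rule: finite_psubset_induct)
    case (psubset T)
    have "path_sum2 (Y c) w xa T (moore_det (Y c)) = path_sum X w T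
        (\<lambda>m S. xa m * moore_det (Y c) S - (c * v m) * path_sum2 (Y c) w xa S (moore_det (Y c)))"
      unfolding Y_def by (rule path_sum_resolvent[OF psubset.hyps(1)])
    also have "\<dots> = path_sum X w T (\<lambda>m S. xa m * D S + (xa m * G S - v m * R S) * c)"
    proof (rule path_sum_cong)
      fix m S assume "S \<subset> T"
      then show "xa m * moore_det (Y c) S - (c * v m) * path_sum2 (Y c) w xa S (moore_det (Y c)) =
          xa m * D S + (xa m * G S - v m * R S) * c"
        using psubset.IH[of S] psubset.prems IH[of S]
        by (simp add: c_comm[of "v m"] c_comm[of "G S"] c_comm[of "R S"] algebra_simps)
    qed
    \<comment> \<open>Here the terms with \<open>c\<close> cancel only after summation, by the
      exchange in \<open>swap\<close>.\<close>
    also have "\<dots> = R T"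
      using swap[OF psubset.prems]
      unfolding path_sum_add_right path_sum_mult_right path_sum_diff_right R_def[of T] by simp
    finally show ?case .
  qed
  let ?F = "\<lambda>m T. Y c m a * moore_det (Y c) T"
  \<comment> \<open>The factor \<open>w a * c\<close> is brought to the far right, where it leaves
    the path sum; the perturbed determinant commutes with it because \<open>Y c\<close> is self-dual
    too.\<close>
  have F: "?F m T = xa m * moore_det (Y c) T + v m * moore_det (Y c) T * (w a * c)"
    if "T \<subseteq> U" for m T
  proof -
    have "c * v m * w a * moore_det (Y c) T = v m * moore_det (Y c) T * (w a * c)"
      using c_comm[of "v m * w a"]
        central_if_conj_fixed[OF cq_conj_moore_det[OF cq_conj_Y[OF c] finite_sub[OF that]], where p = "w a * c"]
      by (simp add: mult.assoc)
    then show ?thesis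
      by (simp add: Y_def xa_def algebra_simps)
  qed
  have Fw: "path_sum (Y c) w T ?F = R T + G T * (w a * c)" if "T \<subseteq> U" for T
  proof -
    have "path_sum (Y c) w T ?F = path_sum (Y c) w T
        (\<lambda>m T. xa m * moore_det (Y c) T + v m * moore_det (Y c) T * (w a * c))"
      using that by (intro path_sum_cong F) auto
    then show ?thesis
      using Y_sub[OF that] Y_col[OF that] by (simp add: path_sum_add_right path_sum_mult_right)
  qed
  have "path_sum (Y c) (X a) U ?F = path_sum X (X a) U
      (\<lambda>m T. ?F m T - (c * v m) * path_sum (Y c) w T ?F)"
    unfolding Y_def by (rule path_sum_resolvent[OF U(1)])
  \<comment> \<open>The quadratic terms in \<open>c\<close>, one from the exit weight and one from a
    perturbed step, cancel because \<open>G T\<close> is central.\<close>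
  also have "\<dots> = path_sum X (X a) U
      (\<lambda>m T. xa m * D T + (xa m * G T + v m * D T * w a - v m * R T) * c)"
  proof (rule path_sum_cong)
    fix m T assume "T \<subset> U"
    then have T: "T \<subseteq> U"
      by blast
    show "?F m T - (c * v m) * path_sum (Y c) w T ?F =
        xa m * D T + (xa m * G T + v m * D T * w a - v m * R T) * c"
      unfolding F[OF T] Fw[OF T] unfolding IH[OF T]
      by (simp add: c_comm[of "v m"] c_comm[of "w a"] c_comm[of "G T"] c_comm[of "R T"]
          c_lcomm[of "w a"] c_lcomm[of "G T"] algebra_simps)
  qed
  also have "\<dots> = C U + (path_sum2 X (X a) xa U G + L U * w a - path_sum2 X (X a) v U R) * c"
    by (simp add: path_sum_add_right path_sum_mult_right path_sum_diff_right C_def L_def)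
  finally have FX: "path_sum (Y c) (X a) U ?F =
      C U + (path_sum2 X (X a) xa U G + L U * w a - path_sum2 X (X a) v U R) * c" .
  \<comment> \<open>Centrality of \<open>G U\<close> cancels the last quadratic terms, from the
    corner \<open>Y c a a\<close> and from the perturbed part of row \<open>a\<close>.\<close>
  have G_left: "G U * (w a * p) = w a * (G U * p)" for p
    by (metis G_central[OF U(1)] mult.assoc)
  have "path_sum (Y c) (Y c a) U ?F = path_sum (Y c) (X a) U ?F + (c * v a) * path_sum (Y c) w U ?F"
    unfolding Y_def[of c, THEN fun_cong, of a] by (rule path_sum_add_left)
  moreover have "moore_det (Y c) (insert a U) =
      Y c a a * moore_det (Y c) U - path_sum (Y c) (Y c a) U ?F"
    by (rule moore_det_insert_Max[OF U])
  ultimately have "moore_det (Y c) (insert a U) = Y c a a * (D U + c * G U) -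
      (C U + (path_sum2 X (X a) xa U G + L U * w a - path_sum2 X (X a) v U R) * c +
       (c * v a) * (R U + G U * (w a * c)))"
    using FX Fw[of U] IH[of U] by simp
  also have "\<dots> = D (insert a U) + c * k"
    unfolding insert_D[OF subset_refl] Y_def k_def
    by (simp add: c_comm[of "v a"] c_comm[of "w a"] c_comm[of "G U"] c_comm[of "D U"] c_comm[of "R U"]
        c_comm[of "path_sum2 X (X a) xa U G"] c_comm[of "path_sum2 X (X a) v U R"] c_comm[of "L U"]
        c_comm[of "X a a"] c_lcomm[of "X a a"] c_lcomm[of "L U"]
        c_lcomm[of "w a"] c_lcomm[of "G U"] c_lcomm[of "v a"] G_left algebra_simps)
  finally show ?thesis .
qed

text \<open>
  A path through \<open>a\<close> from \<open>v\<^sup>*\<close> to \<open>v\<close> and the corresponding cycle through \<open>a\<close> containing the step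
  \<open>v v\<^sup>*\<close> are cyclic rotations of each other, so only their scalar parts can be compared.
\<close>

private lemma qs_k: "qs k = qs (G (insert a U))"
proof -
  have "path_sum X w U (\<lambda>m T. v m * D (insert a T) - xa m * (v a * D T - L T)) =
      path_sum X w U (\<lambda>m T. v m * D T * X a a - v m * C T - xa m * D T * v a + xa m * L T)"
  proof (rule path_sum_cong)
    fix m T assume "T \<subset> U"
    then have T: "T \<subseteq> U"
      by blast
    show "v m * D (insert a T) - xa m * (v a * D T - L T) =
        v m * D T * X a a - v m * C T - xa m * D T * v a + xa m * L T"
      unfolding insert_D[OF T] using D_central[OF finite_sub[OF T], of "X a a"] D_central[OF finite_sub[OF T], of "v a"]
      by (simp add: algebra_simps)
  qed
  also have "\<dots> = G U * X a a - path_sum2 X w v U C - R U * v a + path_sum2 X w xa U L"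
    by (simp add: path_sum_add_right path_sum_mult_right path_sum_diff_right G_def R_def)
  \<comment> \<open>A full equality, since \<open>C\<close> is central.\<close>
  also have "path_sum2 X w v U C = path_sum2 X (X a) xa U G"
    unfolding C_def G_def
    by (rule path_sum2_swap)
       (use U in \<open>auto intro!: D_central C_central[unfolded C_def] finite_sub\<close>)
  finally have "G (insert a U) = w a * (v a * D U - L U) +
      (G U * X a a - path_sum2 X (X a) xa U G - R U * v a + path_sum2 X w xa U L)"
    unfolding G_def[of "insert a U"] using U(1) a_notin_U by (subst path_sum_insert) (simp_all add: L_def xa_def)
  \<comment> \<open>\<open>R\<close> and \<open>L\<close> need not be scalars, so this exchange is
    made under the trace only.\<close>
  moreover have "qs (path_sum2 X w xa U L) = qs (path_sum2 X (X a) v U R)"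
    unfolding L_def R_def
    by (rule qs_path_sum2_swap) (use U in \<open>auto intro!: D_central finite_sub\<close>)
  moreover have "qs (w a * (v a * D U)) = qs (v a * (w a * D U))"
    using qs_mult_commute[of "w a" "v a * D U"] D_central[OF U(1), of "w a"]
    by (simp add: mult.assoc)
  ultimately show ?thesis
    unfolding k_def
    by (simp add: right_diff_distrib qs_add qs_diff mult.assoc
        qs_mult_commute[of "X a a"] qs_mult_commute[of "L U"] qs_mult_commute[of "v a" "R U"])
qed

text \<open>As \<open>k\<close> does not depend on \<open>c\<close>, it can be read off at
  \<open>c = 1\<close> as a difference of two self-dual determinants. It is thus a scalar, and the
  comparison of scalar parts suffices.\<close>

private lemma k_eq:
  assumes "\<And>T. T \<subseteq> U \<Longrightarrow> moore_det (Y 1) T = D T + 1 * G T"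
  shows "k = G (insert a U)"
proof (rule conj_fixed_eqI)
  have "k = moore_det (Y 1) (insert a U) - D (insert a U)"
    using expansion[of 1] assms by simp
  then show "cq_conj k = k"
    using U(1) by (simp add: cq_conj_diff D_fixed cq_conj_moore_det[OF cq_conj_Y])
qed (use U(1) qs_k in \<open>simp_all add: G_fixed\<close>)

text \<open>The induction hypothesis is needed for two values: the given \<open>c\<close> for the
  expansion, and 1 for the identification of \<open>k\<close>.\<close>

lemma moore_det_rank_one_insert:
  assumes "\<And>T c. T \<subseteq> U \<Longrightarrow> cq_conj c = c \<Longrightarrow> moore_det (Y c) T = D T + c * G T"
    and "cq_conj c = c"
  shows "moore_det (Y c) (insert a U) = D (insert a U) + c * G (insert a U)"
  using expansion[OF assms(2) assms(1)] k_eq[OF assms(1)] assms(2) by simp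

end

lemma moore_det_rank_one:
  assumes "finite S" "cq_conj c = c"
  shows "moore_det (\<lambda>i j. X i j + c * v i * cq_conj (v j)) S =
    moore_det X S + c * path_sum2 X (\<lambda>i. cq_conj (v i)) v S (moore_det X)"
proof -
  have "moore_det (Y c) S = D S + c * G S"
    using assms
  proof (induction "card S" arbitrary: S c rule: less_induct)
    case less
    show ?case
    proof (cases "S = {}")
      case False
      obtain a U where S: "S = insert a U"
        and U: "finite U" "\<And>x. x \<in> U \<Longrightarrow> x < a" and card: "card U < card S"
        using finite_Max_insertE[OF less.prems(1) False] by blast
      have IH: "moore_det (Y d) T = D T + d * G T" if "T \<subseteq> U" "cq_conj d = d" for T d
        using that U(1) card card_mono[OF U(1) that(1)]
        by (intro less.hyps) (auto intro: finite_subset)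
      show ?thesis
        unfolding S by (rule moore_det_rank_one_insert[OF U IH less.prems(2)])
    qed (simp add: G_def)
  qed
  then show ?thesis
    by (simp add: Y_def G_def w_def[abs_def])
qed

end

section \<open>Affine dependence on each eigenvalue\<close>

lemma cq_of_complex_mult: "cq_of_complex (a * b) = cq_of_complex a * cq_of_complex b"
  by (simp add: cq_of_complex_def times_cquat_def)

lemma cq_of_complex_add: "cq_of_complex (a + b) = cq_of_complex a + cq_of_complex b"
  by (simp add: cq_of_complex_def plus_cquat_def)

lemma cq_of_complex_diff: "cq_of_complex (a - b) = cq_of_complex a - cq_of_complex b"
  by (simp add: cq_of_complex_def minus_cquat_def)

lemma cq_of_complex_0 [simp]: "cq_of_complex 0 = 0"
  by (simp add: cq_of_complex_def zero_cquat_def)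

lemma cq_of_complex_1 [simp]: "cq_of_complex 1 = 1"
  by (simp add: cq_of_complex_def one_cquat_def)

lemma cq_of_complex_sum: "cq_of_complex (\<Sum>i\<in>A. f i) = (\<Sum>i\<in>A. cq_of_complex (f i))"
  by (induction A rule: infinite_finite_induct) (simp_all add: cq_of_complex_add)

lemma cq_conj_diag_kernel: "cq_conj (diag_kernel I b u x y) = diag_kernel I b u y x"
  unfolding diag_kernel_def cq_conj_sum
  by (intro sum.cong refl)
     (simp add: cq_conj_mult mult.assoc central_if_conj_fixed[OF cq_conj_of_complex])

lemma diag_kernel_cong:
  "(\<And>k. k \<in> I \<Longrightarrow> b k = b' k) \<Longrightarrow> diag_kernel I b u = diag_kernel I b' u"
  unfolding diag_kernel_def by (intro ext sum.cong) simp_all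

text \<open>Changing one eigenvalue is a rank-one perturbation, so the determinant is affine in it
  and interpolates linearly between its values at 0 and 1.\<close>

lemma DetM_diag_kernel_convex:
  fixes b :: "'i \<Rightarrow> complex"
  assumes "finite I" "k \<in> I"
  shows "DetM n (\<lambda>i j. diag_kernel I b u (x i) (x j)) =
    cq_of_complex (b k) * DetM n (\<lambda>i j. diag_kernel I (b(k := 1)) u (x i) (x j)) +
    cq_of_complex (1 - b k) * DetM n (\<lambda>i j. diag_kernel I (b(k := 0)) u (x i) (x j))"
proof -
  define X where "X = (\<lambda>i j. diag_kernel I (b(k := 0)) u (x i) (x j))"
  define G where "G = path_sum2 X (\<lambda>i. cq_conj (u k (x i))) (\<lambda>i. u k (x i)) {..<n} (moore_det X)"
  have affine: "DetM n (\<lambda>i j. diag_kernel I (b(k := t)) u (x i) (x j)) =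
      moore_det X {..<n} + cq_of_complex t * G" for t
  proof -
    have "diag_kernel I (b(k := t)) u y z =
        diag_kernel I (b(k := 0)) u y z + cq_of_complex t * u k y * cq_conj (u k z)" for y z
      using assms unfolding diag_kernel_def by (simp add: sum.remove)
    then show ?thesis
      unfolding DetM_eq_moore_det G_def X_def
      using moore_det_rank_one[where X = "\<lambda>i j. diag_kernel I (b(k := 0)) u (x i) (x j)"
          and v = "\<lambda>i. u k (x i)" and c = "cq_of_complex t" and S = "{..<n}"]
      by (simp add: cq_conj_diag_kernel)
  qed
  show ?thesis
    using affine[of "b k"] affine[of 1] affine[of 0]
    by (simp add: cq_of_complex_diff algebra_simps)
qed

section \<open>Bernoulli mixtures\<close>

text \<open>Polymorphic because it serves both as a real probability and as a complex
  coefficient.\<close>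

definition bernoulli_weight :: "'i set \<Rightarrow> ('i \<Rightarrow> 'b::comm_ring_1) \<Rightarrow> 'i set \<Rightarrow> 'b" where
  "bernoulli_weight J p A = (\<Prod>k\<in>A. p k) * (\<Prod>k\<in>J - A. 1 - p k)"

lemma of_real_bernoulli_weight:
  "complex_of_real (bernoulli_weight J p A) = bernoulli_weight J (\<lambda>k. complex_of_real (p k)) A"
  by (simp add: bernoulli_weight_def)

text \<open>Interpolating one coordinate after the other expresses \<open>f\<close> by its values at
  the vertices of the cube; coordinates outside \<open>J\<close> stay untouched.\<close>

lemma multiaffine_expansion:
  fixes f :: "('i \<Rightarrow> complex) \<Rightarrow> cquat"
  assumes "finite J"
    and f: "\<And>b k. k \<in> J \<Longrightarrow> f b = cq_of_complex (b k) * f (b(k := 1)) +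
      cq_of_complex (1 - b k) * f (b(k := 0))"
  shows "f b = (\<Sum>A\<in>Pow J. cq_of_complex (bernoulli_weight J b A) *
    f (\<lambda>k. if k \<in> J then of_bool (k \<in> A) else b k))"
  using assms
proof (induction J arbitrary: b rule: finite_induct)
  case (insert k J)
  let ?t = "\<lambda>J b A. cq_of_complex (bernoulli_weight J b A) *
    f (\<lambda>k. if k \<in> J then of_bool (k \<in> A) else b k)"
  have IH: "f b = (\<Sum>A\<in>Pow J. ?t J b A)" for b
    using insert.prems by (intro insert.IH) auto
  \<comment> \<open>The weight over \<open>J\<close> does not see coordinate \<open>k\<close>, so
    the value \<open>s\<close> put there is free; it is chosen as 0 or 1 below.\<close>
  have weight: "bernoulli_weight (insert k J) b A = (1 - b k) * bernoulli_weight J (b(k := s)) A"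
      "bernoulli_weight (insert k J) b (insert k A) = b k * bernoulli_weight J (b(k := s)) A"
    if "A \<subseteq> J" for A s
  proof -
    have *: "k \<notin> A" "finite A" "finite (J - A)" "insert k J - A = insert k (J - A)"
        "insert k J - insert k A = J - A" "k \<notin> J - A"
      using that insert.hyps by (auto intro: finite_subset)
    have upd: "(b(k := s)) i = b i" if "i \<in> J" for i
      using that insert.hyps by auto
    have "(\<Prod>i\<in>A. (b(k := s)) i) = prod b A"
      using that by (intro prod.cong refl upd) auto
    moreover have "(\<Prod>i\<in>J - A. 1 - (b(k := s)) i) = (\<Prod>i\<in>J - A. 1 - b i)"
      using that by (intro prod.cong refl arg_cong[where f = "\<lambda>z. 1 - z"] upd) auto
    ultimately show "bernoulli_weight (insert k J) b A = (1 - b k) * bernoulli_weight J (b(k := s)) A"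
        "bernoulli_weight (insert k J) b (insert k A) = b k * bernoulli_weight J (b(k := s)) A"
      unfolding bernoulli_weight_def *(4,5) using *(1,2,3,6) by (simp_all add: mult.left_commute)
  qed
  have "(\<Sum>A\<in>Pow (insert k J). ?t (insert k J) b A) =
      (\<Sum>A\<in>Pow J. ?t (insert k J) b A) + (\<Sum>A\<in>insert k ` Pow J. ?t (insert k J) b A)"
    unfolding Pow_insert using insert.hyps by (intro sum.union_disjoint) auto
  also have "(\<Sum>A\<in>insert k ` Pow J. ?t (insert k J) b A) =
      (\<Sum>A\<in>Pow J. ?t (insert k J) b (insert k A))"
    using insert.hyps by (intro sum.reindex_cong[of "insert k"] inj_onI) auto
  also have "\<dots> = (\<Sum>A\<in>Pow J. cq_of_complex (b k) * ?t J (b(k := 1)) A)"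
  proof (intro sum.cong refl)
    fix A assume A: "A \<in> Pow J"
    have "(\<lambda>i. if i \<in> insert k J then of_bool (i \<in> insert k A) else b i) =
        (\<lambda>i. if i \<in> J then of_bool (i \<in> A) else (b(k := 1)) i)"
      using insert.hyps by auto
    then show "?t (insert k J) b (insert k A) = cq_of_complex (b k) * ?t J (b(k := 1)) A"
      using weight(2)[of A 1] A by (simp add: cq_of_complex_mult mult.assoc)
  qed
  also have "(\<Sum>A\<in>Pow J. ?t (insert k J) b A) =
      (\<Sum>A\<in>Pow J. cq_of_complex (1 - b k) * ?t J (b(k := 0)) A)"
  proof (intro sum.cong refl)
    fix A assume A: "A \<in> Pow J"
    have "(\<lambda>i. if i \<in> insert k J then of_bool (i \<in> A) else b i) =
        (\<lambda>i. if i \<in> J then of_bool (i \<in> A) else (b(k := 0)) i)"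
      using insert.hyps A by (intro ext) auto
    then show "?t (insert k J) b A = cq_of_complex (1 - b k) * ?t J (b(k := 0)) A"
      using weight(1)[of A 0] A by (simp add: cq_of_complex_mult mult.assoc)
  qed
  also have "(\<Sum>A\<in>Pow J. cq_of_complex (1 - b k) * ?t J (b(k := 0)) A) +
      (\<Sum>A\<in>Pow J. cq_of_complex (b k) * ?t J (b(k := 1)) A) =
      cq_of_complex (1 - b k) * f (b(k := 0)) + cq_of_complex (b k) * f (b(k := 1))"
    by (simp only: IH[of "b(k := 0)"] IH[of "b(k := 1)"] sum_distrib_left)
  also have "\<dots> = f b"
    using insert.prems[of k b] by (simp only: insertI1 add.commute)
  finally show ?case ..
qed (simp add: bernoulli_weight_def)

text \<open>The vertices of the cube are the kernels that keep exactly the eigenfunctions in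
  \<open>A\<close>; indicators match the possible values of the Bernoulli variables.\<close>

lemma DetM_diag_kernel_expansion:
  assumes "finite I"
  shows "DetM n (\<lambda>i j. diag_kernel I b u (x i) (x j)) =
    (\<Sum>A\<in>Pow I. cq_of_complex (bernoulli_weight I b A) *
      DetM n (\<lambda>i j. diag_kernel I (\<lambda>k. complex_of_real (indicator A k)) u (x i) (x j)))"
proof -
  define f where "f b = DetM n (\<lambda>i j. diag_kernel I b u (x i) (x j))" for b
  have kernel: "diag_kernel I (\<lambda>k. if k \<in> I then of_bool (k \<in> A) else b k) u =
      diag_kernel I (\<lambda>k. complex_of_real (indicator A k)) u" for A
    by (rule diag_kernel_cong) (simp add: indicator_def)
  have "f b = cq_of_complex (b k) * f (b(k := 1)) + cq_of_complex (1 - b k) * f (b(k := 0))"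
    if "k \<in> I" for b k
    unfolding f_def using assms that by (rule DetM_diag_kernel_convex)
  from multiaffine_expansion[of I f, OF assms this]
  have "f b = (\<Sum>A\<in>Pow I. cq_of_complex (bernoulli_weight I b A) *
    f (\<lambda>k. if k \<in> I then of_bool (k \<in> A) else b k))"
    by blast
  then show ?thesis
    unfolding f_def kernel .
qed

section \<open>Correlation functions of a mixture of laws\<close>

lemma num_points_measurable [measurable]:
  assumes "A \<in> sets M"
  shows "num_points A \<in> borel_measurable (config_space M)"
proof (rule measurableI)
  let ?G = "{num_points A -` B \<inter> configurations | A B. A \<in> sets M \<and> B \<in> sets borel}"
  have G: "?G \<subseteq> Pow configurations"
    by auto
  fix B :: "ennreal set" assume "B \<in> sets borel"
  then have "num_points A -` B \<inter> configurations \<in> ?G"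
    using assms by blast
  then show "num_points A -` B \<inter> space (config_space M) \<in> sets (config_space M)"
    using G unfolding config_space_def by (simp add: space_measure_of sets_measure_of)
qed simp

lemma falling_measurable [measurable]:
  assumes [measurable]: "f \<in> borel_measurable M"
  shows "(\<lambda>w. falling (f w) k) \<in> borel_measurable M"
  unfolding falling_def by measurable

lemma block_product_sets:
  assumes M: "space M = UNIV" and A: "\<And>i. i < m \<Longrightarrow> A i \<in> sets M" and k: "k = (\<Sum>i<m. \<kappa> i)"
  shows "block_product m \<kappa> A \<in> sets (PiM {..<k} (\<lambda>_. M))"
proof -
  have le: "(\<Sum>l<Suc i. \<kappa> l) \<le> k" if "i < m" for i
    unfolding k using that by (intro sum_mono2) auto
  have "block_product m \<kappa> A = {x \<in> space (PiM {..<k} (\<lambda>_. M)).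
      \<forall>i\<in>{..<m}. \<forall>j\<in>{(\<Sum>l<i. \<kappa> l)..<(\<Sum>l<Suc i. \<kappa> l)}. x j \<in> A i}"
    by (auto simp: block_product_def space_PiM M k)
  also have "\<dots> \<in> sets (PiM {..<k} (\<lambda>_. M))"
  proof (intro sets.sets_Collect_finite_All finite_lessThan finite_atLeastLessThan)
    fix i j assume i: "i \<in> {..<m}" and j: "j \<in> {(\<Sum>l<i. \<kappa> l)..<(\<Sum>l<Suc i. \<kappa> l)}"
    have "(\<lambda>x. x j) \<in> measurable (PiM {..<k} (\<lambda>_. M)) M"
      using i j le[of i] by (intro measurable_component_singleton) auto
    from measurable_sets[OF this A[of i]]
    show "{x \<in> space (PiM {..<k} (\<lambda>_. M)). x j \<in> A i} \<in> sets (PiM {..<k} (\<lambda>_. M))"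
      using i by (simp add: vimage_def Int_def conj_commute)
  qed
  finally show ?thesis .
qed

text \<open>The factorial moments are linear in the law, and nonnegativity lets the finite average
  pass through the integral of the correlation functions.\<close>

lemma correlation_function_mixture:
  assumes M: "space M = UNIV" and R: "\<And>a. a \<in> \<A> \<Longrightarrow> correlation_function M (P a) k (R a)"
    and p: "\<And>a. a \<in> \<A> \<Longrightarrow> 0 \<le> p a"
    and P: "\<And>f. f \<in> borel_measurable (config_space M) \<Longrightarrow>
      (\<integral>\<^sup>+w. f w \<partial>Q) = (\<Sum>a\<in>\<A>. ennreal (p a) * (\<integral>\<^sup>+w. f w \<partial>P a))"
  shows "correlation_function M Q k (\<lambda>x. \<Sum>a\<in>\<A>. p a * R a x)"
  unfolding correlation_function_def
proof (intro conjI allI impI)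
  let ?M = "PiM {..<k} (\<lambda>_. M)"
  have meas [measurable]: "R a \<in> borel_measurable ?M" and nonneg: "0 \<le> R a x" if "a \<in> \<A>" for a x
    using R[OF that] by (auto simp: correlation_function_def)
  show "(\<lambda>x. \<Sum>a\<in>\<A>. p a * R a x) \<in> borel_measurable ?M"
    by (intro borel_measurable_sum borel_measurable_times borel_measurable_const meas)
  show "0 \<le> (\<Sum>a\<in>\<A>. p a * R a x)" for x
    by (intro sum_nonneg mult_nonneg_nonneg p nonneg)
  show "locally_integrable M k (\<lambda>x. \<Sum>a\<in>\<A>. p a * R a x)"
    unfolding locally_integrable_def
  proof (intro allI impI)
    fix C assume "compact C \<and> C \<in> sets M"
    then have "set_integrable ?M ({..<k} \<rightarrow>\<^sub>E C) (R a)" if "a \<in> \<A>" for a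
      using R[OF that] by (auto simp: correlation_function_def locally_integrable_def)
    then show "set_integrable ?M ({..<k} \<rightarrow>\<^sub>E C) (\<lambda>x. \<Sum>a\<in>\<A>. p a * R a x)"
      unfolding set_integrable_def scaleR_sum_right
      by (intro Bochner_Integration.integrable_sum) (simp add: mult.left_commute)
  qed
  fix m :: nat and \<kappa> :: "nat \<Rightarrow> nat" and A :: "nat \<Rightarrow> 'a set"
  assume *: "(\<forall>i<m. A i \<in> sets M) \<and> disjoint_family_on A {..<m} \<and> (\<Sum>i<m. \<kappa> i) = k"
  let ?B = "block_product m \<kappa> A"
  have B [measurable]: "?B \<in> sets ?M"
    using * by (intro block_product_sets M) auto
  have "(\<integral>\<^sup>+w. (\<Prod>i<m. falling (num_points (A i) w) (\<kappa> i)) \<partial>Q) =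
      (\<Sum>a\<in>\<A>. ennreal (p a) * (\<integral>\<^sup>+w. (\<Prod>i<m. falling (num_points (A i) w) (\<kappa> i)) \<partial>P a))"
    using * by (intro P borel_measurable_prod_ennreal falling_measurable num_points_measurable) auto
  also have "\<dots> = (\<Sum>a\<in>\<A>. ennreal (p a) * (\<integral>\<^sup>+x\<in>?B. ennreal (R a x) \<partial>?M))"
    using R * by (intro sum.cong refl arg_cong2[where f = "(*)"]) (simp add: correlation_function_def)
  also have "\<dots> = (\<Sum>a\<in>\<A>. \<integral>\<^sup>+x. ennreal (p a) * (ennreal (R a x) * indicator ?B x) \<partial>?M)"
    by (intro sum.cong refl nn_integral_cmult[symmetric]) measurable
  also have "\<dots> = (\<integral>\<^sup>+x. (\<Sum>a\<in>\<A>. ennreal (p a) * (ennreal (R a x) * indicator ?B x)) \<partial>?M)"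
    by (intro nn_integral_sum[symmetric]) measurable
  also have "\<dots> = (\<integral>\<^sup>+x\<in>?B. ennreal (\<Sum>a\<in>\<A>. p a * R a x) \<partial>?M)"
  proof (intro nn_integral_cong)
    fix x
    have "ennreal (\<Sum>a\<in>\<A>. p a * R a x) = (\<Sum>a\<in>\<A>. ennreal (p a) * ennreal (R a x))"
      by (subst sum_ennreal[symmetric]) (auto intro!: sum.cong mult_nonneg_nonneg p nonneg ennreal_mult)
    then show "(\<Sum>a\<in>\<A>. ennreal (p a) * (ennreal (R a x) * indicator ?B x)) =
        ennreal (\<Sum>a\<in>\<A>. p a * R a x) * indicator ?B x"
      by (simp add: sum_distrib_right mult.assoc)
  qed
  finally show "(\<integral>\<^sup>+w. (\<Prod>i<m. falling (num_points (A i) w) (\<kappa> i)) \<partial>Q) =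
      (\<integral>\<^sup>+x\<in>?B. ennreal (\<Sum>a\<in>\<A>. p a * R a x) \<partial>?M)" .
qed

section \<open>Conditioning on independent Bernoulli variables\<close>

context prob_space
begin

text \<open>The law of total expectation; it is restricted to events of positive probability because
  \<open>uniform_measure\<close> is a conditional law only there.\<close>

lemma nn_integral_partition:
  assumes fin: "finite \<A>" and E: "\<And>a. a \<in> \<A> \<Longrightarrow> E a \<in> events"
    and disj: "disjoint_family_on E \<A>" and cover: "AE w in M. \<exists>a\<in>\<A>. w \<in> E a"
    and f [measurable]: "f \<in> borel_measurable M"
  shows "(\<integral>\<^sup>+w. f w \<partial>M) =
    (\<Sum>a | a \<in> \<A> \<and> prob (E a) > 0. ennreal (prob (E a)) * (\<integral>\<^sup>+w. f w \<partial>uniform_measure M (E a)))"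
proof -
  have "AE w in M. f w = (\<Sum>a\<in>\<A>. f w * indicator (E a) w)"
    using cover
  proof eventually_elim
    case (elim w)
    then obtain a where a: "a \<in> \<A>" "w \<in> E a"
      by blast
    then have "indicator (E b) w = (if b = a then 1 else 0 :: ennreal)" if "b \<in> \<A>" for b
      using disj that by (auto simp: disjoint_family_on_def indicator_def)
    then have "(\<Sum>b\<in>\<A>. f w * indicator (E b) w) = (\<Sum>b\<in>\<A>. if b = a then f w else 0)"
      by (intro sum.cong) auto
    then show ?case
      using fin a by simp
  qed
  then have "(\<integral>\<^sup>+w. f w \<partial>M) = (\<integral>\<^sup>+w. (\<Sum>a\<in>\<A>. f w * indicator (E a) w) \<partial>M)"
    by (rule nn_integral_cong_AE)
  also have "\<dots> = (\<Sum>a\<in>\<A>. \<integral>\<^sup>+w. f w * indicator (E a) w \<partial>M)"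
    using E by (intro nn_integral_sum) auto
  also have "\<dots> = (\<Sum>a | a \<in> \<A> \<and> prob (E a) > 0. \<integral>\<^sup>+w. f w * indicator (E a) w \<partial>M)"
  proof (intro sum.mono_neutral_right ballI fin)
    fix a assume "a \<in> \<A> - {a \<in> \<A>. prob (E a) > 0}"
    then have "prob (E a) = 0" "E a \<in> events"
      using E measure_nonneg[of M "E a"] by (auto simp: less_le)
    then have "E a \<in> null_sets M"
      by (simp add: null_sets_def emeasure_eq_measure)
    then show "(\<integral>\<^sup>+w. f w * indicator (E a) w \<partial>M) = 0"
      by (rule nn_integral_null_set)
  qed auto
  also have "\<dots> = (\<Sum>a | a \<in> \<A> \<and> prob (E a) > 0.
      ennreal (prob (E a)) * (\<integral>\<^sup>+w. f w \<partial>uniform_measure M (E a)))"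
  proof (intro sum.cong refl)
    fix a assume "a \<in> {a \<in> \<A>. prob (E a) > 0}"
    then show "(\<integral>\<^sup>+w. f w * indicator (E a) w \<partial>M) =
        ennreal (prob (E a)) * (\<integral>\<^sup>+w. f w \<partial>uniform_measure M (E a))"
      using E by (simp add: nn_integral_uniform_measure emeasure_eq_measure ennreal_times_divide
          mult.commute[of "ennreal _"] ennreal_mult_divide_eq)
  qed
  finally show ?thesis .
qed

context
  fixes I :: "'i set" and \<xi> :: "'i \<Rightarrow> 'a \<Rightarrow> real" and p :: "'i \<Rightarrow> real"
  assumes I: "finite I" and indep: "indep_vars (\<lambda>_. borel) \<xi> I"
    and one: "\<And>k. k \<in> I \<Longrightarrow> prob {w \<in> space M. \<xi> k w = 1} = p k"
    and zero: "\<And>k. k \<in> I \<Longrightarrow> prob {w \<in> space M. \<xi> k w = 0} = 1 - p k"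
begin

private lemma rv [measurable]: "k \<in> I \<Longrightarrow> \<xi> k \<in> borel_measurable M"
  using indep by (auto simp: indep_vars_def)

lemma bernoulli_event_sets: "{w \<in> space M. \<forall>k\<in>I. \<xi> k w = indicator A k} \<in> events"
  using I by measurable

lemma prob_bernoulli_event:
  assumes "A \<subseteq> I"
  shows "prob {w \<in> space M. \<forall>k\<in>I. \<xi> k w = indicator A k} = bernoulli_weight I p A"
proof (cases "I = {}")
  case True
  then show ?thesis
    using assms by (simp add: bernoulli_weight_def prob_space)
next
  \<comment> \<open>For nonempty \<open>I\<close> the intersection stays inside
    \<open>space M\<close>; over the empty set it would be the whole type.\<close>
  case False
  have "{w \<in> space M. \<forall>k\<in>I. \<xi> k w = indicator A k} = (\<Inter>k\<in>I. \<xi> k -` {indicator A k} \<inter> space M)"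
    using False by auto
  also have "prob \<dots> = (\<Prod>k\<in>I. prob (\<xi> k -` {indicator A k} \<inter> space M))"
    using False I by (intro indep_varsD_finite[OF indep]) auto
  also have "\<dots> = (\<Prod>k\<in>I. if k \<in> A then p k else 1 - p k)"
  proof (intro prod.cong refl)
    fix k assume k: "k \<in> I"
    have "\<xi> k -` {indicator A k} \<inter> space M = {w \<in> space M. \<xi> k w = (if k \<in> A then 1 else 0)}"
      by (auto simp: indicator_def)
    then show "prob (\<xi> k -` {indicator A k} \<inter> space M) = (if k \<in> A then p k else 1 - p k)"
      using one[OF k] zero[OF k] by simp
  qed
  also have "\<dots> = bernoulli_weight I p A"
    using assms I by (simp add: bernoulli_weight_def prod.If_cases Int_absorb1 Diff_eq)
  finally show ?thesis .
qed

text \<open>The probabilities of the values 0 and 1 add up to 1, so almost surely every variable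
  takes one of them.\<close>

lemma AE_bernoulli_event:
  "AE w in M. \<exists>A\<in>Pow I. w \<in> {w \<in> space M. \<forall>k\<in>I. \<xi> k w = indicator A k}"
proof -
  have "AE w in M. \<xi> k w = 1 \<or> \<xi> k w = 0" if k: "k \<in> I" for k
  proof -
    have "{w \<in> space M. \<xi> k w = 1 \<or> \<xi> k w = 0} = {w \<in> space M. \<xi> k w = 1} \<union> {w \<in> space M. \<xi> k w = 0}"
      by auto
    also have "prob \<dots> = 1"
      using k one[OF k] zero[OF k] by (subst finite_measure_Union) auto
    finally show ?thesis
      using k by (subst (asm) prob_Collect_eq_1) auto
  qed
  then have "AE w in M. \<forall>k\<in>I. \<xi> k w = 1 \<or> \<xi> k w = 0"
    using I by (intro AE_finite_allI)
  with AE_space show ?thesis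
  proof eventually_elim
    case (elim w)
    then have "\<forall>k\<in>I. \<xi> k w = indicator {k \<in> I. \<xi> k w = 1} k"
      by (auto simp: indicator_def)
    with elim(1) have "w \<in> {w' \<in> space M. \<forall>k\<in>I. \<xi> k w' = indicator {k \<in> I. \<xi> k w = 1} k}"
      by blast
    then show ?case
      by blast
  qed
qed

end

end

section \<open>Averaging the determinantal formula over the Bernoulli variables\<close>

theorem theorem1p6:
  fixes M :: "'a::topological_space measure"
    and N :: "'w measure"
    and I :: "'i set"
    and lam :: "'i \<Rightarrow> real"
    and u :: "'i \<Rightarrow> 'a \<Rightarrow> cquat"
    and K :: "'a \<Rightarrow> 'a \<Rightarrow> cquat"
    and \<xi> :: "'i \<Rightarrow> 'w \<Rightarrow> real"
    and X :: "'w \<Rightarrow> 'a \<Rightarrow> nat"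
  assumes "sets borel \<subseteq> sets M"
    and "diagonal_form M I (\<lambda>k. complex_of_real (lam k)) u K"
    and "\<And>k. k \<in> I \<Longrightarrow> 0 \<le> lam k \<and> lam k \<le> 1"
    and "completely_positive M I u K"
    and "prob_space N"
    and "prob_space.indep_vars N (\<lambda>_. borel) \<xi> I"
    and "\<And>k. k \<in> I \<Longrightarrow> measure N {w \<in> space N. \<xi> k w = 1} = lam k"
    and "\<And>k. k \<in> I \<Longrightarrow> measure N {w \<in> space N. \<xi> k w = 0} = 1 - lam k"
    and "pfaffian_mixture M N I \<xi> (\<lambda>b. diag_kernel I (\<lambda>k. complex_of_real (b k)) u) X"
  shows "pfaffian_field M K (distr N (config_space M) X)"
proof -
  interpret N: prob_space N
    by fact
  have I: "finite I" and K: "K = diag_kernel I (\<lambda>k. complex_of_real (lam k)) u"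
    using assms(2) by (auto simp: diagonal_form_def)
  have X [measurable]: "X \<in> measurable N (config_space M)"
    using assms(9) by (simp add: pfaffian_mixture_def)
  \<comment> \<open>\<open>block_product\<close> ranges over all points of the type, hence the need
    for \<open>space M = UNIV\<close>.\<close>
  have "UNIV \<in> sets M"
    using assms(1) by auto
  then have M: "space M = UNIV"
    using sets.sets_into_space by blast
  define E where "E A = {w \<in> space N. \<forall>k\<in>I. \<xi> k w = indicator A k}" for A
  \<comment> \<open>Only outcomes of positive probability are kept: the mixture prescribes
    conditional laws for these.\<close>
  define \<A> where "\<A> = {A \<in> Pow I. measure N (E A) > 0}"
  define P where "P A = distr (uniform_measure N (E A)) (config_space M) X" for A
  define KA where "KA A = diag_kernel I (\<lambda>k. complex_of_real (indicator A k)) u" for A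
  have fin: "finite \<A>"
    using I by (simp add: \<A>_def)
  have E [measurable]: "E A \<in> sets N" for A
    unfolding E_def by (rule N.bernoulli_event_sets[OF I assms(6-8)])
  have prob_E: "measure N (E A) = bernoulli_weight I lam A" if "A \<subseteq> I" for A
    unfolding E_def by (rule N.prob_bernoulli_event[OF I assms(6-8) that])
  have pfaffian: "pfaffian_field M (KA A) (P A)" if "A \<in> \<A>" for A
    using assms(9) that unfolding pfaffian_mixture_def Let_def \<A>_def KA_def P_def E_def by blast
  have disj: "disjoint_family_on E (Pow I)"
    unfolding disjoint_family_on_def
  proof (intro ballI impI)
    fix A B assume "A \<in> Pow I" "B \<in> Pow I" "A \<noteq> B"
    then obtain k where "k \<in> I" "k \<in> A \<longleftrightarrow> k \<notin> B"
      by blast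
    then have "k \<in> I" "indicator A k \<noteq> (indicator B k :: real)"
      by (auto simp: indicator_def)
    then show "E A \<inter> E B = {}"
      by (auto simp: E_def)
  qed
  have cover: "AE w in N. \<exists>A\<in>Pow I. w \<in> E A"
    unfolding E_def by (rule N.AE_bernoulli_event[OF I assms(6-8)])
  have mixture: "(\<integral>\<^sup>+w. f w \<partial>distr N (config_space M) X) =
      (\<Sum>A\<in>\<A>. ennreal (measure N (E A)) * (\<integral>\<^sup>+w. f w \<partial>P A))"
    if [measurable]: "f \<in> borel_measurable (config_space M)" for f
  proof -
    have "(\<integral>\<^sup>+w. f w \<partial>distr N (config_space M) X) = (\<integral>\<^sup>+w. f (X w) \<partial>N)"
      by (rule nn_integral_distr) measurable
    also have "\<dots> = (\<Sum>A\<in>\<A>. ennreal (measure N (E A)) * (\<integral>\<^sup>+w. f (X w) \<partial>uniform_measure N (E A)))"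
      unfolding \<A>_def using I by (intro N.nn_integral_partition disj cover E) auto
    also have "\<dots> = (\<Sum>A\<in>\<A>. ennreal (measure N (E A)) * (\<integral>\<^sup>+w. f w \<partial>P A))"
      unfolding P_def by (simp add: nn_integral_distr)
    finally show ?thesis .
  qed
  show ?thesis
    unfolding pfaffian_field_def
  proof (intro conjI allI impI)
    show "random_point_field M (distr N (config_space M) X)"
      by (simp add: random_point_field_def N.prob_space_distr)
    show "self_dual_kernel K"
      by (simp add: self_dual_kernel_def K cq_conj_diag_kernel)
    fix m :: nat assume m: "1 \<le> m"
    have "\<forall>A\<in>\<A>. \<exists>R. correlation_function M (P A) m R \<and> (AE x in PiM {..<m} (\<lambda>_. M).
        DetM m (\<lambda>i j. KA A (x i) (x j)) = cq_of_complex (of_real (R x)))"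
      using pfaffian m by (simp add: pfaffian_field_def)
    then obtain R where R: "\<And>A. A \<in> \<A> \<Longrightarrow> correlation_function M (P A) m (R A)"
      and det: "\<And>A. A \<in> \<A> \<Longrightarrow> AE x in PiM {..<m} (\<lambda>_. M).
        DetM m (\<lambda>i j. KA A (x i) (x j)) = cq_of_complex (of_real (R A x))"
      by (auto dest!: bchoice)
    \<comment> \<open>The correlation function of the mixture is the average of the conditional
      ones.\<close>
    let ?R = "\<lambda>x. \<Sum>A\<in>\<A>. measure N (E A) * R A x"
    have corr: "correlation_function M (distr N (config_space M) X) m ?R"
      by (rule correlation_function_mixture[OF M R _ mixture]) auto
    \<comment> \<open>Finitely many exceptional null sets are merged into one.\<close>
    have "AE x in PiM {..<m} (\<lambda>_. M). \<forall>A\<in>\<A>.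
        DetM m (\<lambda>i j. KA A (x i) (x j)) = cq_of_complex (of_real (R A x))"
      by (rule AE_finite_allI[OF fin det])
    then have "AE x in PiM {..<m} (\<lambda>_. M).
        DetM m (\<lambda>i j. K (x i) (x j)) = cq_of_complex (of_real (?R x))"
    proof eventually_elim
      case (elim x)
      have "DetM m (\<lambda>i j. K (x i) (x j)) =
          (\<Sum>A\<in>Pow I. cq_of_complex (bernoulli_weight I (\<lambda>k. complex_of_real (lam k)) A) *
            DetM m (\<lambda>i j. KA A (x i) (x j)))"
        unfolding K KA_def by (rule DetM_diag_kernel_expansion[OF I])
      also have "\<dots> = (\<Sum>A\<in>Pow I. cq_of_complex (of_real (measure N (E A))) *
          DetM m (\<lambda>i j. KA A (x i) (x j)))"
        by (intro sum.cong refl) (simp add: prob_E of_real_bernoulli_weight)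
      \<comment> \<open>Outcomes of probability 0 have weight 0 in the multiaffine expansion, so
        both averages run over the same sets.\<close>
      also have "\<dots> = (\<Sum>A\<in>\<A>. cq_of_complex (of_real (measure N (E A))) *
          DetM m (\<lambda>i j. KA A (x i) (x j)))"
        using I by (intro sum.mono_neutral_right) (auto simp: \<A>_def zero_less_measure_iff)
      also have "\<dots> = cq_of_complex (of_real (?R x))"
        using elim by (simp add: cq_of_complex_sum cq_of_complex_mult)
      finally show ?case .
    qed
    with corr show "\<exists>R. correlation_function M (distr N (config_space M) X) m R \<and>
        (AE x in PiM {..<m} (\<lambda>_. M). DetM m (\<lambda>i j. K (x i) (x j)) = cq_of_complex (of_real (R x)))"
      by blast
  qed
qed

end
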